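(* Assume objective regularity, i.e. $\nabla f,\nabla g$ are jointly Lipschitz in $(x,y)$ with constants $\ell_{f,1},\ell_{g,1}$; for every $x$, $g(x,\cdot)$ is $\rho_g$-strongly convex for some $\rho_g>0$; $f,g\in C^2$ with $\nabla^2f,\nabla^2g$ jointly Lipschitz in $(x,y)$ with constants $\ell_{f,2},\ell_{g,2}$; and for all $(x,y)$, $\|\nabla_xf(x,y)\|_2\le\ell_{f,0}$, $\|\nabla_yf(x,y)\|_2\le\ell_{f,0}$ and $\|\nabla_xg(x,y)\|_2\le\ell_{g,0}$. Fix an integer $T\ge1$, let $c_\xi>0$ be a sufficiently small absolute numerical constant, let the local Dikin constants be fixed as described in the context, and let $\{\alpha_k,\gamma_k,\lambda_k,\delta_k\}_{k\ge0}$ be a barrier-aware schedule. Let the iterates be generated by the barrier-metric first-order algorithm with initial warm starts satisfying $z_0\in T_{\eta,\mu}(x_0)$ and $y_0\in T^{\lambda_0}_{\eta,\mu}(x_0)$. Then for every outer iteration $k$, all inner iterates $z_k^{(t)}$ ($0\le t\le T$) of the exact tracker remain in $T_{\eta,\mu}(x_k)$, all inner iterates $y_k^{(t)}$ ($0\le t\le T$) of the proxy tracker remain in $T^{\lambda_k}_{\eta,\mu}(x_k)$, and the next warm starts satisfy $z_{k+1}\in T_{\eta,\mu}(x_{k+1})$ and $y_{k+1}\in T^{\lambda_{k+1}}_{\eta,\mu}(x_{k+1})$. In particular, the moving exact and proxy Dikin neighborhoods are forward invariant.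
   Context: Problem. $Y=\{y\in\mathbb R^{d_y}:Ay\le b\}$ is a compact full-dimensional polytope with nonempty interior, $a_i^\top$ ($i=1,\dots,m$) the rows of $A$; $X=\mathbb R^{d_x}$; $f,g:\mathbb R^{d_x}\times\mathbb R^{d_y}\to\mathbb R$. With $y^\star(x)=\arg\min_{y\in Y}g(x,y)$ one assumes $\inf_xf(x,y^\star(x))>-\infty$. Objective regularity: (A1) $\nabla f,\nabla g$ jointly Lipschitz with constants $\ell_{f,1},\ell_{g,1}$; (A2) $g(x,\cdot)$ is $\rho_g$-strongly convex for every $x$, $\rho_g>0$; (A3) $f,g\in C^2$ with $\nabla^2f,\nabla^2g$ jointly Lipschitz with constants $\ell_{f,2},\ell_{g,2}$; (A4) for all $(x,y)$, $\|\nabla_xf\|_2,\|\nabla_yf\|_2\le\ell_{f,0}$ and $\|\nabla_xg\|_2\le\ell_{g,0}$. Barrier objects ($\mu>0$ fixed). $\phi(y)=-\sum_i\log(b_i-a_i^\top y)$; $\psi_\mu(x,y)=g(x,y)+\mu\phi(y)$; $y_\mu^\star(x)=\arg\min_{y\in\operatorname{int}(Y)}\psi_\mu(x,y)$; $\psi_\mu^\star(x)=\min_{\operatorname{int}(Y)}\psi_\mu(x,\cdot)$; $F_\mu(x)=f(x,y_\mu^\star(x))$; $L_{\lambda,\mu}(x,y)=f(x,y)+\lambda(\psi_\mu(x,y)-\psi_\mu^\star(x))$; $y^\star_{\lambda,\mu}(x)\in\arg\min_{y\in\operatorname{int}(Y)}L_{\lambda,\mu}(x,y)$. Dikin geometry.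 For $c\in\operatorname{int}(Y)$: $H_c=\nabla^2\phi(c)$, $\|u\|_c^2=\langle H_cu,u\rangle$, $\|w\|_{c,*}^2=\langle H_c^{-1}w,w\rangle$, $\|M\|_{2\to c,*}=\sup_{\|u\|_2=1}\|Mu\|_{c,*}$, $\|M\|_{c\to c,*}=\sup_{\|u\|_c=1}\|Mu\|_{c,*}$, $\|M\|_{2\to c}=\sup_{\|u\|_2=1}\|Mu\|_c$. For $r>0$: $T_{r,\mu}(x)=\{y\in\operatorname{int}(Y):\|y-y_\mu^\star(x)\|_{y_\mu^\star(x)}\le r\}$ and $T^\lambda_{r,\mu}(x)=\{y\in\operatorname{int}(Y):\|y-y^\star_{\lambda,\mu}(x)\|_{y^\star_{\lambda,\mu}(x)}\le r\}$. A radius $\eta\in(0,1/2)$ is fixed. $\nabla^2_{xy}h\in\mathbb R^{d_y\times d_x}$ is the $x$-derivative of $\nabla_yh$. Local Dikin constants. $\rho_\psi^\eta>0$, $\ell_{\psi,1}^\eta,\ell_{\psi,2}^\eta,\ell_{f,0}^\eta,\ell_{f,1}^\eta,\ell_{f,2}^\eta$ and a threshold $\lambda_\eta<\infty$ are finite constants, depending on $\eta,\mu,Y$ and the regularity constants only, such that for all $x$, and for both choices $(c,\mathcal T)=(y_\mu^\star(x),T_{2\eta,\mu}(x))$ and $(c,\mathcal T)=(y^\star_{\lambda,\mu}(x),T^\lambda_{2\eta,\mu}(x))$ with any $\lambda\ge\lambda_\eta$, and all $y,y_1,y_2\in\mathcal T$: $\rho_\psi^\eta H_c\preceq\nabla^2_{yy}\psi_\mu(x,y)\preceq\ell_{\psi,1}^\eta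 H_c$; $\|\nabla^2_{xy}\psi_\mu(x,y)\|_{2\to c,*}\le\ell_{\psi,1}^\eta$; $\|\nabla^2_{yy}\psi_\mu(x,y_1)-\nabla^2_{yy}\psi_\mu(x,y_2)\|_{c\to c,*}$ and $\|\nabla^2_{xy}\psi_\mu(x,y_1)-\nabla^2_{xy}\psi_\mu(x,y_2)\|_{2\to c,*}$ are $\le\ell_{\psi,2}^\eta\|y_1-y_2\|_c$; $\|\nabla_yf(x,y)\|_{c,*}\le\ell_{f,0}^\eta$; $\|\nabla^2_{xy}f(x,y)\|_{2\to c,*}\le\ell_{f,1}^\eta$; $\|\nabla^2_{yy}f(x,y)\|_{c\to c,*}\le\ell_{f,1}^\eta$; and the differences of $\nabla^2_{xy}f,\nabla^2_{yy}f$ satisfy the analogous Lipschitz bounds with $\ell_{f,2}^\eta$. Further $\ell_{*,0}^\eta\ge1$, $\ell_{\lambda,0}^\eta$, $L_F^\eta$, $\ell_{\lambda,1}^\eta$, $\ell_{*,1}^\eta\ge\max\{1,\ell_{\lambda,1}^\eta\}$ are finite constants such that for all $x_1,x_2$ and $\lambda,\lambda_1,\lambda_2\ge\lambda_0$: $\|y_\mu^\star(x_2)-y_\mu^\star(x_1)\|_{y_\mu^\star(x_1)}\le\ell_{*,0}^\eta\|x_2-x_1\|_2$; $\|y^\star_{\lambda_2,\mu}(x_2)-y^\star_{\lambda_1,\mu}(x_1)\|_{y^\star_{\lambda_1,\mu}(x_1)}\le\frac{2\ell_{f,0}^\eta}{\rho_\psi^\eta}|\frac1{\lambda_2}-\frac1{\lambda_1}|+\ell_{\lambda,0}^\eta\|x_2-x_1\|_2$;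 $\|\nabla F_\mu(x_2)-\nabla F_\mu(x_1)\|_2\le L_F^\eta\|x_2-x_1\|_2$; and the Jacobians satisfy $\|\nabla y_\mu^\star(x_2)-\nabla y_\mu^\star(x_1)\|_{2\to y_\mu^\star(x_1)}\le\ell_{*,1}^\eta\|x_2-x_1\|_2$ and $\|\nabla y^\star_{\lambda,\mu}(x_2)-\nabla y^\star_{\lambda,\mu}(x_1)\|_{2\to y^\star_{\lambda,\mu}(x_1)}\le\ell_{\lambda,1}^\eta\|x_2-x_1\|_2$. Conventions on $\eta$ and constants. With $\theta_\eta=(1-\eta)^{-2}-1$, $\eta$ is small enough that $\theta_\eta L\le m/4$ for the curvature pairs $(m,L)=(\rho_\psi^\eta,\ell_{\psi,1}^\eta)$ and $(m,L)=(\lambda\rho_\psi^\eta/2,\lambda\ell_{\psi,1}^\eta+\ell_{f,1}^\eta)$, $\lambda\ge\lambda_0$. The local Dikin constants are understood after absorbing fixed $\eta$-dependent factors coming from comparing the frozen metrics $\nabla^2\phi(z_k),\nabla^2\phi(y_k)$ with the center metrics ($\rho_\psi^\eta$ decreased, the other constants increased). The initial multiplier satisfies $\lambda_0\ge\lambda_\eta$. Algorithm (inner length $T$, ratio $\xi>0$, $x_0\in\mathbb R^{d_x}$, $y_0,z_0\in\operatorname{int}(Y)$). For $k=0,1,\dots$: $z_k^{(0)}=z_k$, $y_k^{(0)}=y_k$; for $t=0,\dots,T-1$, $z_k^{(t+1)}=z_k^{(t)}-\gamma_k\nabla^2\phi(z_k)^{-1}\nabla_y\psi_\mu(x_k,z_k^{(t)})$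 and $y_k^{(t+1)}=y_k^{(t)}-\alpha_k\nabla^2\phi(y_k)^{-1}\bigl(\nabla_yf(x_k,y_k^{(t)})+\lambda_k\nabla_y\psi_\mu(x_k,y_k^{(t)})\bigr)$; then $z_{k+1}=z_k^{(T)}$, $y_{k+1}=y_k^{(T)}$, $q_k^x=\nabla_xf(x_k,y_{k+1})+\lambda_k(\nabla_xg(x_k,y_{k+1})-\nabla_xg(x_k,z_{k+1}))$, $x_{k+1}=x_k-\xi\alpha_kq_k^x$, $\lambda_{k+1}=\lambda_k+\delta_k$. Barrier-aware schedule. With $\beta_k=\alpha_k\lambda_k$, for all $k$: (S1) $\lambda_0\ge\max\{2\ell_{f,1}^\eta/\rho_\psi^\eta,\ 8\ell_{f,0}^\eta/(\eta\rho_\psi^\eta)\}$, $\beta_k\le\gamma_k\le\min\{1/(4\ell_{\psi,1}^\eta),\ 1/(4T\rho_\psi^\eta)\}$, $\alpha_k\le1/(2\xi L_F^\eta)$; (S2) $\delta_k/\lambda_k\le T\rho_\psi^\eta\beta_k/16$, $\delta_k=\lambda_{k+1}-\lambda_k\ge0$; (S3) with $D=\ell_{f,0}/\lambda_0+2\ell_{g,0}$, $$\frac\xi T\le\min\Bigl\{\frac{\eta\rho_\psi^\eta}{16\ell_{*,0}^\eta D},\ \frac{\eta\rho_\psi^\eta}{64\ell_{\lambda,0}^\eta D},\ \frac{c_\xi\rho_\psi^\eta}{\max\{\ell_{\psi,1}^\eta(\ell_{*,0}^\eta)^2,\ \ell_{*,1}^\eta\sqrt{\max(\ell_{g,0}^2,\ell_{f,0}^2)}\}}\Bigr\}.$$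 *)

theory Defs
  imports "HOL-Analysis.Analysis"
begin

section \<open>Gradients and Hessians\<close>

definition grad :: "('a::real_inner \<Rightarrow> real) \<Rightarrow> 'a \<Rightarrow> 'a" where
  "grad h p = (THE v. GDERIV h p :> v)"

definition hessian :: "(real^'d \<Rightarrow> real) \<Rightarrow> real^'d \<Rightarrow> real^'d^'d" where
  "hessian h y = jacobian (grad h) (at y)"

text \<open>The Hessian of a function of \<open>p = (x, y)\<close> is kept as a bounded linear operator on the
  (Euclidean) product space, so that its norm is the spectral norm of the full Hessian.\<close>

definition hess_op :: "('a::real_inner \<Rightarrow> real) \<Rightarrow> 'a \<Rightarrow> 'a \<Rightarrow>\<^sub>L 'a" where
  "hess_op h p = Blinfun (frechet_derivative (grad h) (at p))"

definition C2 :: "('a::real_inner \<Rightarrow> real) \<Rightarrow> bool" where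
  "C2 h \<longleftrightarrow> (\<forall>p. h differentiable (at p)) \<and> (\<forall>p. grad h differentiable (at p))
     \<and> continuous_on UNIV (hess_op h)"

definition grad_x :: "((real^'n) \<times> (real^'d) \<Rightarrow> real) \<Rightarrow> real^'n \<Rightarrow> real^'d \<Rightarrow> real^'n" where
  "grad_x h x y = grad (\<lambda>x'. h (x', y)) x"

definition grad_y :: "((real^'n) \<times> (real^'d) \<Rightarrow> real) \<Rightarrow> real^'n \<Rightarrow> real^'d \<Rightarrow> real^'d" where
  "grad_y h x y = grad (\<lambda>y'. h (x, y')) y"

definition hess_yy :: "((real^'n) \<times> (real^'d) \<Rightarrow> real) \<Rightarrow> real^'n \<Rightarrow> real^'d \<Rightarrow> real^'d^'d" where
  "hess_yy h x y = hessian (\<lambda>y'. h (x, y')) y"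

definition hess_xy :: "((real^'n) \<times> (real^'d) \<Rightarrow> real) \<Rightarrow> real^'n \<Rightarrow> real^'d \<Rightarrow> real^'n^'d" where
  "hess_xy h x y = jacobian (\<lambda>x'. grad_y h x' y) (at x)"


section \<open>Objective regularity\<close>

definition strongly_convex :: "real \<Rightarrow> ('a::real_inner \<Rightarrow> real) \<Rightarrow> bool" where
  "strongly_convex \<rho> h \<longleftrightarrow> (\<forall>u v t. 0 \<le> t \<and> t \<le> 1 \<longrightarrow>
     h (t *\<^sub>R u + (1 - t) *\<^sub>R v)
       \<le> t * h u + (1 - t) * h v - \<rho> / 2 * t * (1 - t) * (norm (u - v))\<^sup>2)"

record regularity_constants =
  lf0 :: real
  lf1 :: real
  lf2 :: real
  lg0 :: real
  lg1 :: real
  lg2 :: real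
  rho_g :: real

definition objective_regularity ::
  "((real^'n) \<times> (real^'d) \<Rightarrow> real) \<Rightarrow> ((real^'n) \<times> (real^'d) \<Rightarrow> real) \<Rightarrow> regularity_constants \<Rightarrow> bool"
where
  "objective_regularity f g R \<longleftrightarrow>
     (lf1 R)-lipschitz_on UNIV (grad f) \<and> (lg1 R)-lipschitz_on UNIV (grad g)
   \<and> rho_g R > 0 \<and> (\<forall>x. strongly_convex (rho_g R) (\<lambda>y. g (x, y)))
   \<and> C2 f \<and> C2 g
   \<and> (lf2 R)-lipschitz_on UNIV (hess_op f) \<and> (lg2 R)-lipschitz_on UNIV (hess_op g)
   \<and> (\<forall>x y. norm (grad_x f x y) \<le> lf0 R \<and> norm (grad_y f x y) \<le> lf0 R
          \<and> norm (grad_x g x y) \<le> lg0 R)"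


section \<open>The polytope and its barrier\<close>

definition Ypoly :: "real^'d^'m \<Rightarrow> real^'m \<Rightarrow> (real^'d) set" where
  "Ypoly A b = {y. \<forall>i. row i A \<bullet> y \<le> b $ i}"

definition barrier :: "real^'d^'m \<Rightarrow> real^'m \<Rightarrow> real^'d \<Rightarrow> real" where
  "barrier A b y = - (\<Sum>i\<in>UNIV. ln (b $ i - row i A \<bullet> y))"

definition barrier_hess :: "real^'d^'m \<Rightarrow> real^'m \<Rightarrow> real^'d \<Rightarrow> real^'d^'d" where
  "barrier_hess A b c = hessian (barrier A b) c"

definition lower_sol ::
  "real^'d^'m \<Rightarrow> real^'m \<Rightarrow> ((real^'n) \<times> (real^'d) \<Rightarrow> real) \<Rightarrow> real^'n \<Rightarrow> real^'d" where
  "lower_sol A b g x = arg_min_on (\<lambda>y. g (x, y)) (Ypoly A b)"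

definition psi :: "real^'d^'m \<Rightarrow> real^'m \<Rightarrow> ((real^'n) \<times> (real^'d) \<Rightarrow> real) \<Rightarrow> real
    \<Rightarrow> (real^'n) \<times> (real^'d) \<Rightarrow> real" where
  "psi A b g \<mu> p = g p + \<mu> * barrier A b (snd p)"

definition y_mu :: "real^'d^'m \<Rightarrow> real^'m \<Rightarrow> ((real^'n) \<times> (real^'d) \<Rightarrow> real) \<Rightarrow> real
    \<Rightarrow> real^'n \<Rightarrow> real^'d" where
  "y_mu A b g \<mu> x = arg_min_on (\<lambda>y. psi A b g \<mu> (x, y)) (interior (Ypoly A b))"

definition psi_min :: "real^'d^'m \<Rightarrow> real^'m \<Rightarrow> ((real^'n) \<times> (real^'d) \<Rightarrow> real) \<Rightarrow> real
    \<Rightarrow> real^'n \<Rightarrow> real" where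
  "psi_min A b g \<mu> x = (INF y\<in>interior (Ypoly A b). psi A b g \<mu> (x, y))"

definition F_mu :: "real^'d^'m \<Rightarrow> real^'m \<Rightarrow> ((real^'n) \<times> (real^'d) \<Rightarrow> real)
    \<Rightarrow> ((real^'n) \<times> (real^'d) \<Rightarrow> real) \<Rightarrow> real \<Rightarrow> real^'n \<Rightarrow> real" where
  "F_mu A b f g \<mu> x = f (x, y_mu A b g \<mu> x)"

definition lagr :: "real^'d^'m \<Rightarrow> real^'m \<Rightarrow> ((real^'n) \<times> (real^'d) \<Rightarrow> real)
    \<Rightarrow> ((real^'n) \<times> (real^'d) \<Rightarrow> real) \<Rightarrow> real \<Rightarrow> real \<Rightarrow> real^'n \<Rightarrow> real^'d \<Rightarrow> real" where
  "lagr A b f g \<mu> lam x y = f (x, y) + lam * (psi A b g \<mu> (x, y) - psi_min A b g \<mu> x)"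

text \<open>The penalized minimizer need not be unique for small \<open>lam\<close>, so it is an arbitrary selection
  \<open>ylam lam x\<close> from the set of minimizers.\<close>

definition penalized_selection :: "real^'d^'m \<Rightarrow> real^'m \<Rightarrow> ((real^'n) \<times> (real^'d) \<Rightarrow> real)
    \<Rightarrow> ((real^'n) \<times> (real^'d) \<Rightarrow> real) \<Rightarrow> real \<Rightarrow> (real \<Rightarrow> real^'n \<Rightarrow> real^'d) \<Rightarrow> bool" where
  "penalized_selection A b f g \<mu> ylam \<longleftrightarrow>
     (\<forall>lam>0. \<forall>x. is_arg_min (lagr A b f g \<mu> lam x) (\<lambda>y. y \<in> interior (Ypoly A b)) (ylam lam x))"


section \<open>Dikin geometry\<close>

text \<open>The norms take the metric matrix \<open>H\<close>, which is always \<open>barrier_hess A b c\<close> below.\<close>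

definition mnorm :: "real^'d^'d \<Rightarrow> real^'d \<Rightarrow> real" where
  "mnorm H u = sqrt ((H *v u) \<bullet> u)"

definition mnorm_dual :: "real^'d^'d \<Rightarrow> real^'d \<Rightarrow> real" where
  "mnorm_dual H w = sqrt ((matrix_inv H *v w) \<bullet> w)"

definition onorm_2_dual :: "real^'d^'d \<Rightarrow> real^'n^'d \<Rightarrow> real" where
  "onorm_2_dual H M = (SUP u\<in>{u. norm u = 1}. mnorm_dual H (M *v u))"

definition onorm_c_dual :: "real^'d^'d \<Rightarrow> real^'d^'d \<Rightarrow> real" where
  "onorm_c_dual H M = (SUP u\<in>{u. mnorm H u = 1}. mnorm_dual H (M *v u))"

definition onorm_2_c :: "real^'d^'d \<Rightarrow> real^'n^'d \<Rightarrow> real" where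
  "onorm_2_c H M = (SUP u\<in>{u. norm u = 1}. mnorm H (M *v u))"

definition loewner_le :: "real^'d^'d \<Rightarrow> real^'d^'d \<Rightarrow> bool" where
  "loewner_le M N \<longleftrightarrow> (\<forall>u. (M *v u) \<bullet> u \<le> (N *v u) \<bullet> u)"

definition dikin_ball :: "real^'d^'m \<Rightarrow> real^'m \<Rightarrow> real \<Rightarrow> real^'d \<Rightarrow> (real^'d) set" where
  "dikin_ball A b r c = {y \<in> interior (Ypoly A b). mnorm (barrier_hess A b c) (y - c) \<le> r}"

definition T_exact :: "real^'d^'m \<Rightarrow> real^'m \<Rightarrow> ((real^'n) \<times> (real^'d) \<Rightarrow> real) \<Rightarrow> real
    \<Rightarrow> real \<Rightarrow> real^'n \<Rightarrow> (real^'d) set" where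
  "T_exact A b g \<mu> r x = dikin_ball A b r (y_mu A b g \<mu> x)"

definition T_proxy :: "real^'d^'m \<Rightarrow> real^'m \<Rightarrow> (real \<Rightarrow> real^'n \<Rightarrow> real^'d)
    \<Rightarrow> real \<Rightarrow> real \<Rightarrow> real^'n \<Rightarrow> (real^'d) set" where
  "T_proxy A b ylam r lam x = dikin_ball A b r (ylam lam x)"


section \<open>Local Dikin constants\<close>

record dikin_constants =
  rho_psi_eta :: real
  lpsi1_eta :: real
  lpsi2_eta :: real
  lf0_eta :: real
  lf1_eta :: real
  lf2_eta :: real
  lam_eta :: real
  lstar0_eta :: real
  lstar1_eta :: real
  llam0_eta :: real
  llam1_eta :: real
  LF_eta :: real

text \<open>The bounds at a fixed \<open>x\<close>, for the metric at the center \<open>c\<close>, on the neighborhood \<open>N\<close>.\<close>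

definition local_bounds :: "real^'d^'m \<Rightarrow> real^'m \<Rightarrow> ((real^'n) \<times> (real^'d) \<Rightarrow> real)
    \<Rightarrow> ((real^'n) \<times> (real^'d) \<Rightarrow> real) \<Rightarrow> real \<Rightarrow> dikin_constants
    \<Rightarrow> real^'n \<Rightarrow> real^'d \<Rightarrow> (real^'d) set \<Rightarrow> bool" where
  "local_bounds A b f g \<mu> K x c N \<longleftrightarrow>
    (let H = barrier_hess A b c; \<psi> = psi A b g \<mu> in
     (\<forall>y\<in>N.
        loewner_le (rho_psi_eta K *\<^sub>R H) (hess_yy \<psi> x y)
      \<and> loewner_le (hess_yy \<psi> x y) (lpsi1_eta K *\<^sub>R H)
      \<and> onorm_2_dual H (hess_xy \<psi> x y) \<le> lpsi1_eta K
      \<and> mnorm_dual H (grad_y f x y) \<le> lf0_eta K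
      \<and> onorm_2_dual H (hess_xy f x y) \<le> lf1_eta K
      \<and> onorm_c_dual H (hess_yy f x y) \<le> lf1_eta K)
   \<and> (\<forall>y1\<in>N. \<forall>y2\<in>N.
        onorm_c_dual H (hess_yy \<psi> x y1 - hess_yy \<psi> x y2) \<le> lpsi2_eta K * mnorm H (y1 - y2)
      \<and> onorm_2_dual H (hess_xy \<psi> x y1 - hess_xy \<psi> x y2) \<le> lpsi2_eta K * mnorm H (y1 - y2)
      \<and> onorm_c_dual H (hess_yy f x y1 - hess_yy f x y2) \<le> lf2_eta K * mnorm H (y1 - y2)
      \<and> onorm_2_dual H (hess_xy f x y1 - hess_xy f x y2) \<le> lf2_eta K * mnorm H (y1 - y2)))"

text \<open>Only positive multipliers are meaningful, so the quantifier over \<open>lam \<ge> lam_eta\<close> is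
  restricted to them; this matters only if the given \<open>lam_eta\<close> is not positive.\<close>

definition local_constants :: "real^'d^'m \<Rightarrow> real^'m \<Rightarrow> ((real^'n) \<times> (real^'d) \<Rightarrow> real)
    \<Rightarrow> ((real^'n) \<times> (real^'d) \<Rightarrow> real) \<Rightarrow> real \<Rightarrow> (real \<Rightarrow> real^'n \<Rightarrow> real^'d) \<Rightarrow> real
    \<Rightarrow> dikin_constants \<Rightarrow> bool" where
  "local_constants A b f g \<mu> ylam \<eta> K \<longleftrightarrow>
     rho_psi_eta K > 0
   \<and> (\<forall>x. local_bounds A b f g \<mu> K x (y_mu A b g \<mu> x) (T_exact A b g \<mu> (2 * \<eta>) x))
   \<and> (\<forall>x lam. lam \<ge> lam_eta K \<and> lam > 0 \<longrightarrow>
        local_bounds A b f g \<mu> K x (ylam lam x) (T_proxy A b ylam (2 * \<eta>) lam x))"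

text \<open>Differentiability is spelled out because \<open>jacobian\<close> and \<open>grad\<close> are total functions.\<close>

definition path_constants :: "real^'d^'m \<Rightarrow> real^'m \<Rightarrow> ((real^'n) \<times> (real^'d) \<Rightarrow> real)
    \<Rightarrow> ((real^'n) \<times> (real^'d) \<Rightarrow> real) \<Rightarrow> real \<Rightarrow> (real \<Rightarrow> real^'n \<Rightarrow> real^'d) \<Rightarrow> real
    \<Rightarrow> dikin_constants \<Rightarrow> bool" where
  "path_constants A b f g \<mu> ylam lam0 K \<longleftrightarrow>
    (let ys = y_mu A b g \<mu>; F = F_mu A b f g \<mu>; H = barrier_hess A b in
     lstar0_eta K \<ge> 1 \<and> lstar1_eta K \<ge> max 1 (llam1_eta K)
   \<and> (\<forall>x1 x2. mnorm (H (ys x1)) (ys x2 - ys x1) \<le> lstar0_eta K * norm (x2 - x1))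
   \<and> (\<forall>x1 x2 lam1 lam2. lam1 \<ge> lam0 \<and> lam2 \<ge> lam0 \<longrightarrow>
        mnorm (H (ylam lam1 x1)) (ylam lam2 x2 - ylam lam1 x1)
          \<le> 2 * lf0_eta K / rho_psi_eta K * \<bar>1 / lam2 - 1 / lam1\<bar> + llam0_eta K * norm (x2 - x1))
   \<and> (\<forall>x. F differentiable (at x))
   \<and> (\<forall>x1 x2. norm (grad F x2 - grad F x1) \<le> LF_eta K * norm (x2 - x1))
   \<and> (\<forall>x. ys differentiable (at x))
   \<and> (\<forall>x1 x2. onorm_2_c (H (ys x1)) (jacobian ys (at x2) - jacobian ys (at x1))
          \<le> lstar1_eta K * norm (x2 - x1))
   \<and> (\<forall>lam\<ge>lam0. \<forall>x. ylam lam differentiable (at x))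
   \<and> (\<forall>lam\<ge>lam0. \<forall>x1 x2.
        onorm_2_c (H (ylam lam x1)) (jacobian (ylam lam) (at x2) - jacobian (ylam lam) (at x1))
          \<le> llam1_eta K * norm (x2 - x1)))"

definition theta :: "real \<Rightarrow> real" where
  "theta \<eta> = 1 / (1 - \<eta>)\<^sup>2 - 1"

definition radius_small :: "real \<Rightarrow> real \<Rightarrow> dikin_constants \<Rightarrow> bool" where
  "radius_small \<eta> lam0 K \<longleftrightarrow>
     theta \<eta> * lpsi1_eta K \<le> rho_psi_eta K / 4
   \<and> (\<forall>lam\<ge>lam0. theta \<eta> * (lam * lpsi1_eta K + lf1_eta K) \<le> (lam * rho_psi_eta K / 2) / 4)"


section \<open>Algorithm and schedule\<close>

text \<open>\<open>x k\<close>, \<open>z k\<close>, \<open>y k\<close> are the outer iterates and \<open>zi k t\<close>, \<open>yi k t\<close> the inner ones.\<close>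

definition barrier_metric_run :: "real^'d^'m \<Rightarrow> real^'m \<Rightarrow> ((real^'n) \<times> (real^'d) \<Rightarrow> real)
    \<Rightarrow> ((real^'n) \<times> (real^'d) \<Rightarrow> real) \<Rightarrow> real \<Rightarrow> nat \<Rightarrow> real
    \<Rightarrow> (nat \<Rightarrow> real) \<Rightarrow> (nat \<Rightarrow> real) \<Rightarrow> (nat \<Rightarrow> real) \<Rightarrow> (nat \<Rightarrow> real)
    \<Rightarrow> (nat \<Rightarrow> real^'n) \<Rightarrow> (nat \<Rightarrow> real^'d) \<Rightarrow> (nat \<Rightarrow> real^'d)
    \<Rightarrow> (nat \<Rightarrow> nat \<Rightarrow> real^'d) \<Rightarrow> (nat \<Rightarrow> nat \<Rightarrow> real^'d) \<Rightarrow> bool" where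
  "barrier_metric_run A b f g \<mu> T \<xi> \<alpha> \<gamma> lam \<delta> x z y zi yi \<longleftrightarrow>
     z 0 \<in> interior (Ypoly A b) \<and> y 0 \<in> interior (Ypoly A b)
   \<and> (\<forall>k. zi k 0 = z k \<and> yi k 0 = y k
      \<and> (\<forall>t<T. zi k (Suc t) = zi k t - \<gamma> k *\<^sub>R
            (matrix_inv (barrier_hess A b (z k)) *v grad_y (psi A b g \<mu>) (x k) (zi k t)))
      \<and> (\<forall>t<T. yi k (Suc t) = yi k t - \<alpha> k *\<^sub>R
            (matrix_inv (barrier_hess A b (y k)) *v
              (grad_y f (x k) (yi k t) + lam k *\<^sub>R grad_y (psi A b g \<mu>) (x k) (yi k t))))
      \<and> z (Suc k) = zi k T \<and> y (Suc k) = yi k T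
      \<and> x (Suc k) = x k - (\<xi> * \<alpha> k) *\<^sub>R
            (grad_x f (x k) (y (Suc k))
             + lam k *\<^sub>R (grad_x g (x k) (y (Suc k)) - grad_x g (x k) (z (Suc k))))
      \<and> lam (Suc k) = lam k + \<delta> k)"

text \<open>Upper bounds whose denominator can vanish (\<open>LF_eta K\<close>, \<open>llam0_eta K\<close> or \<open>D\<close> equal to
  zero) are stated with the denominator cleared, so that they are then void (the reading
  \<open>1/0 = \<infinity>\<close>) rather than subject to the HOL convention \<open>1/0 = 0\<close>.\<close>

definition barrier_aware_schedule :: "regularity_constants \<Rightarrow> dikin_constants \<Rightarrow> real \<Rightarrow> real
    \<Rightarrow> nat \<Rightarrow> real \<Rightarrow> (nat \<Rightarrow> real) \<Rightarrow> (nat \<Rightarrow> real) \<Rightarrow> (nat \<Rightarrow> real) \<Rightarrow> (nat \<Rightarrow> real) \<Rightarrow> bool"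
where
  "barrier_aware_schedule R K \<eta> c\<^sub>\<xi> T \<xi> \<alpha> \<gamma> lam \<delta> \<longleftrightarrow>
    (let \<beta> = (\<lambda>k. \<alpha> k * lam k); D = lf0 R / lam 0 + 2 * lg0 R; \<rho> = rho_psi_eta K in
     lam 0 > 0 \<and> lam 0 \<ge> max (2 * lf1_eta K / \<rho>) (8 * lf0_eta K / (\<eta> * \<rho>))
   \<and> (\<forall>k. \<beta> k \<le> \<gamma> k \<and> \<gamma> k \<le> min (1 / (4 * lpsi1_eta K)) (1 / (4 * real T * \<rho>))
          \<and> \<alpha> k * (2 * \<xi> * LF_eta K) \<le> 1)
   \<and> (\<forall>k. \<delta> k / lam k \<le> real T * \<rho> * \<beta> k / 16 \<and> \<delta> k = lam (Suc k) - lam k \<and> \<delta> k \<ge> 0)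
   \<and> \<xi> / real T * (16 * lstar0_eta K * D) \<le> \<eta> * \<rho>
   \<and> \<xi> / real T * (64 * llam0_eta K * D) \<le> \<eta> * \<rho>
   \<and> \<xi> / real T \<le> c\<^sub>\<xi> * \<rho> /
        max (lpsi1_eta K * (lstar0_eta K)\<^sup>2) (lstar1_eta K * sqrt (max ((lg0 R)\<^sup>2) ((lf0 R)\<^sup>2))))"

end

theory Submission
  imports Defs
begin

text \<open>Each round of the algorithm is a race between contraction and drift, run in the local norm at the
  current center, i.e. the Dikin norm at the minimizer of the barrier-regularized objective (exact
  tracker) or of the penalized one (proxy tracker).

  Contraction. At the center the gradient vanishes, so an inner step maps the error \<open>e\<close> to
  \<open>e - a P\<^sup>-\<^sup>1 M e\<close>, where \<open>P\<close> is the barrier Hessian frozen at the warm start and \<open>M\<close> is a Hessian of the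
  tracked objective at an intermediate point (\<open>tracker_step\<close>). Its curvature lies between \<open>m\<close> and \<open>L\<close>
  times the center metric \<open>H\<close>. If \<open>P\<close> were \<open>H\<close> then the step would contract by \<open>1 - a m\<close>. As
  the warm start is within local distance \<open>\<eta>\<close> of the center, \<open>P\<^sup>-\<^sup>1\<close> and \<open>H\<^sup>-\<^sup>1\<close> differ by at most
  \<open>theta \<eta>\<close> relative to \<open>H\<^sup>-\<^sup>1\<close>, and the smallness of the radius turns the rate into \<open>1 - 3/4 a m\<close>
  (\<open>preconditioned_step_bound\<close>). The step bound \<open>a L \<le> 1\<close> and the symmetry of \<open>M\<close>
  (\<open>second_derivative_symmetric\<close>) are what make the linear rate possible. So inner iterates never leave
  the ball, and after \<open>T\<close> steps the radius has shrunk by a fraction proportional to \<open>T a m\<close>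
  (\<open>inner_loop_contraction\<close>).

  Drift. The outer step has length at most \<open>\<xi> \<beta> D\<close> (\<open>outer_step_length\<close>), and the centers are Lipschitz in
  \<open>x\<close> and in \<open>1/\<lambda>\<close>. The schedule bounds the resulting motion of either center by a twelfth of \<open>\<eta>\<close> times
  the accumulated contraction rate. Passing to the new center costs this distance and a factor close to
  one for the new metric (\<open>recenter\<close>), which together stay below what the contraction has gained
  (\<open>warm_start_transfer\<close>). The invariant is thus restored and induction over the rounds finishes the proof.

  The self-concordance used here is elementary for a logarithmic barrier: its Hessian is a sum of squares
  of normalized row functionals, so that a local distance below one bounds the relative change of
  every slack (\<open>Dikin_slack\<close>).\<close>

section \<open>Self-adjoint matrices and the norms they define\<close>

text \<open>Self-adjointness is phrased through the inner product rather than through the transpose, since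
  it is only ever used to move a matrix across an inner product.\<close>

definition self_adjoint :: "real^'d^'d \<Rightarrow> bool" where
  "self_adjoint S \<longleftrightarrow> (\<forall>u v. (S *v u) \<bullet> v = u \<bullet> (S *v v))"

definition pos_def :: "real^'d^'d \<Rightarrow> bool" where
  "pos_def H \<longleftrightarrow> self_adjoint H \<and> (\<forall>u. u \<noteq> 0 \<longrightarrow> (H *v u) \<bullet> u > 0)"

lemma self_adjointD: "self_adjoint S \<Longrightarrow> (S *v u) \<bullet> v = u \<bullet> (S *v v)"
  by (simp add: self_adjoint_def)

lemma pos_def_self_adjoint: "pos_def H \<Longrightarrow> self_adjoint H"
  by (simp add: pos_def_def)

lemma pos_def_nonneg: "pos_def H \<Longrightarrow> 0 \<le> (H *v u) \<bullet> u"
  by (cases "u = 0") (auto simp: pos_def_def less_imp_le)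

lemma self_adjoint_add: "self_adjoint S \<Longrightarrow> self_adjoint S' \<Longrightarrow> self_adjoint (S + S')"
  by (simp add: self_adjoint_def matrix_vector_mult_add_rdistrib inner_add_left inner_add_right)

lemma self_adjoint_diff: "self_adjoint S \<Longrightarrow> self_adjoint S' \<Longrightarrow> self_adjoint (S - S')"
  by (simp add: self_adjoint_def matrix_vector_mult_diff_rdistrib inner_diff_left inner_diff_right)

lemma self_adjoint_scaleR: "self_adjoint S \<Longrightarrow> self_adjoint (a *\<^sub>R S)"
  by (simp add: self_adjoint_def flip: scaleR_matrix_vector_assoc)

lemma mnorm_nonneg: "pos_def H \<Longrightarrow> 0 \<le> mnorm H u"
  by (simp add: mnorm_def pos_def_nonneg)

lemma mnorm_square: "pos_def H \<Longrightarrow> (mnorm H u)\<^sup>2 = (H *v u) \<bullet> u"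
  by (simp add: mnorm_def pos_def_nonneg)

lemma mnorm_pos: "pos_def H \<Longrightarrow> u \<noteq> 0 \<Longrightarrow> 0 < mnorm H u"
  by (simp add: mnorm_def pos_def_def)

lemma mnorm_scaleR: "mnorm H (a *\<^sub>R u) = \<bar>a\<bar> * mnorm H u"
proof -
  have "(H *v (a *\<^sub>R u)) \<bullet> (a *\<^sub>R u) = a\<^sup>2 * ((H *v u) \<bullet> u)"
    by (simp add: matrix_vector_mult_scaleR power2_eq_square)
  then show ?thesis by (simp add: mnorm_def real_sqrt_mult)
qed

text \<open>For a self-adjoint matrix the quadratic form controls the bilinear form with the same constant:
  polarize after rescaling the two vectors to equal \<open>H\<close>-length, so that the parallelogram law loses
  nothing. Applied to \<open>H\<close> itself this is the Cauchy--Schwarz inequality; applied to the difference of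
  two metrics or to a Hessian it replaces a spectral norm.\<close>

lemma self_adjoint_bilinear_bound:
  assumes H: "pos_def H" and S: "self_adjoint S"
    and bd: "\<And>u. \<bar>(S *v u) \<bullet> u\<bar> \<le> \<kappa> * ((H *v u) \<bullet> u)"
  shows "\<bar>(S *v u) \<bullet> v\<bar> \<le> \<kappa> * mnorm H u * mnorm H v"
proof (cases "u = 0 \<or> v = 0")
  case True
  then show ?thesis by (auto simp: mnorm_def)
next
  case False
  define a c where "a = mnorm H u" and "c = mnorm H v"
  have ac: "a > 0" "c > 0" using False H by (auto simp: a_def c_def mnorm_pos)
  define p q where "p = c *\<^sub>R u" and "q = a *\<^sub>R v"
  have Hp: "(H *v p) \<bullet> p = (a * c)\<^sup>2" and Hq: "(H *v q) \<bullet> q = (a * c)\<^sup>2"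
    unfolding mnorm_square[OF H, symmetric]
    by (simp_all add: mnorm_scaleR p_def q_def a_def c_def mnorm_nonneg[OF H] mult.commute)
  have "4 * ((S *v p) \<bullet> q) = (S *v (p + q)) \<bullet> (p + q) - (S *v (p - q)) \<bullet> (p - q)"
    using self_adjointD[OF S, of q p]
    by (simp add: matrix_vector_mult_diff_distrib matrix_vector_right_distrib
        inner_add_left inner_add_right inner_diff_left inner_diff_right inner_commute)
  then have "4 * \<bar>(S *v p) \<bullet> q\<bar> \<le> \<kappa> * ((H *v (p + q)) \<bullet> (p + q)) + \<kappa> * ((H *v (p - q)) \<bullet> (p - q))"
    using bd[of "p + q"] bd[of "p - q"] by linarith
  also have "\<dots> = \<kappa> * (4 * (a * c)\<^sup>2)"
    using Hp Hq
    by (simp add: matrix_vector_mult_diff_distrib matrix_vector_right_distrib algebra_simps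
        inner_add_left inner_add_right inner_diff_left inner_diff_right)
  finally have "\<bar>(S *v p) \<bullet> q\<bar> \<le> \<kappa> * (a * c)\<^sup>2" by simp
  moreover have "(S *v p) \<bullet> q = (a * c) * ((S *v u) \<bullet> v)"
    by (simp add: p_def q_def matrix_vector_mult_scaleR)
  ultimately have "(a * c) * \<bar>(S *v u) \<bullet> v\<bar> \<le> (a * c) * (\<kappa> * (a * c))"
    using ac by (simp add: abs_mult power2_eq_square mult.left_commute mult.assoc)
  then show ?thesis using ac by (simp add: a_def c_def mult.assoc)
qed

lemma mnorm_Cauchy_Schwarz:
  assumes "pos_def H" shows "\<bar>(H *v u) \<bullet> v\<bar> \<le> mnorm H u * mnorm H v"
  using self_adjoint_bilinear_bound[OF assms pos_def_self_adjoint[OF assms], of 1]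
  by (simp add: pos_def_nonneg assms)

text \<open>Norm estimates are proved by testing against a vector, which avoids square roots of matrices
  and turns vector-valued mean value estimates into scalar ones.\<close>

lemma mnorm_le_by_duality:
  assumes H: "pos_def H" and le: "\<And>w. (H *v v) \<bullet> w \<le> B * mnorm H w" and B: "0 \<le> B"
  shows "mnorm H v \<le> B"
proof (cases "v = 0")
  case False
  have "mnorm H v * mnorm H v \<le> B * mnorm H v"
    using le[of v] mnorm_square[OF H, of v] by (simp add: power2_eq_square)
  then show ?thesis using mnorm_pos[OF H False] by simp
qed (use B in \<open>simp add: mnorm_def\<close>)

lemma mnorm_triangle:
  assumes H: "pos_def H" shows "mnorm H (u + v) \<le> mnorm H u + mnorm H v"
proof (rule mnorm_le_by_duality[OF H])
  fix w
  show "(H *v (u + v)) \<bullet> w \<le> (mnorm H u + mnorm H v) * mnorm H w"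
    using mnorm_Cauchy_Schwarz[OF H, of u w] mnorm_Cauchy_Schwarz[OF H, of v w]
    by (simp add: matrix_vector_right_distrib inner_add_left distrib_right)
qed (simp add: H mnorm_nonneg)

lemma pos_def_inverse:
  assumes H: "pos_def H"
  shows pos_def_inv_right: "H *v (matrix_inv H *v w) = w"
    and pos_def_inv_left: "matrix_inv H *v (H *v w) = w"
    and pos_def_matrix_inv: "pos_def (matrix_inv H)"
proof -
  have "u = 0" if "H *v u = 0" for u
    using H that by (auto simp: pos_def_def dest!: spec[of _ u])
  then have "invertible H"
    by (auto simp: invertible_left_inverse matrix_left_invertible_ker)
  then have "H ** matrix_inv H = mat 1 \<and> matrix_inv H ** H = mat 1"
    unfolding invertible_def matrix_inv_def by (rule someI_ex)
  then show r: "H *v (matrix_inv H *v w) = w" and l: "matrix_inv H *v (H *v w) = w" for w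
    by (auto simp: matrix_vector_mul_assoc)
  have "(matrix_inv H *v u) \<bullet> v = u \<bullet> (matrix_inv H *v v)" for u v
    using self_adjointD[OF pos_def_self_adjoint[OF H], of "matrix_inv H *v u" "matrix_inv H *v v"]
    by (simp add: r)
  moreover have "(matrix_inv H *v u) \<bullet> u > 0" if "u \<noteq> 0" for u
  proof -
    have "matrix_inv H *v u \<noteq> 0" using r[of u] that by auto
    then have "(H *v (matrix_inv H *v u)) \<bullet> (matrix_inv H *v u) > 0"
      using H by (auto simp: pos_def_def)
    then show ?thesis by (simp add: r inner_commute)
  qed
  ultimately show "pos_def (matrix_inv H)" by (simp add: pos_def_def self_adjoint_def)
qed

lemma mnorm_dual_eq_mnorm_inv: "mnorm_dual H = mnorm (matrix_inv H)"
  by (simp add: mnorm_def mnorm_dual_def fun_eq_iff)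

lemma mnorm_inv_image: "pos_def H \<Longrightarrow> mnorm H (matrix_inv H *v w) = mnorm_dual H w"
  by (simp add: mnorm_def mnorm_dual_def pos_def_inv_right inner_commute)

lemma mnorm_dual_image: "pos_def H \<Longrightarrow> mnorm_dual H (H *v u) = mnorm H u"
  by (simp add: mnorm_def mnorm_dual_def pos_def_inv_left inner_commute)

lemma inner_le_mnorm_dual:
  assumes H: "pos_def H" shows "\<bar>w \<bullet> u\<bar> \<le> mnorm_dual H w * mnorm H u"
  using mnorm_Cauchy_Schwarz[OF H, of "matrix_inv H *v w" u]
  by (simp add: pos_def_inv_right H mnorm_inv_image)

text \<open>Symmetry of \<open>M\<close> is essential: the quadratic form sees only the symmetric part of a matrix, whereas
  this is a bound on the whole operator, from the local norm to its dual.\<close>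

lemma mnorm_dual_le:
  assumes H: "pos_def H" and M: "self_adjoint M" and L: "0 \<le> L"
    and bd: "\<And>u. \<bar>(M *v u) \<bullet> u\<bar> \<le> L * ((H *v u) \<bullet> u)"
  shows "mnorm_dual H (M *v e) \<le> L * mnorm H e"
  unfolding mnorm_inv_image[OF H, symmetric]
proof (rule mnorm_le_by_duality[OF H])
  fix w
  show "(H *v (matrix_inv H *v (M *v e))) \<bullet> w \<le> L * mnorm H e * mnorm H w"
    using self_adjoint_bilinear_bound[OF H M bd, of e w] by (simp add: pos_def_inv_right H)
qed (simp add: L H mnorm_nonneg)

section \<open>Preconditioning with a nearby metric\<close>

text \<open>Inversion reverses the order: the squared dual \<open>H\<close>-norm of \<open>w\<close> is the pairing of \<open>w\<close> with
  \<open>H\<^sup>-\<^sup>1 w\<close>, and Cauchy--Schwarz in the metric \<open>P\<close> followed by the assumed comparison bounds it by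
  \<open>sqrt \<kappa>\<close> times the product of the two dual norms, of which one factor cancels.\<close>

lemma matrix_inv_antitone:
  assumes H: "pos_def H" and P: "pos_def P" and k: "0 < \<kappa>"
    and le: "\<And>u. (P *v u) \<bullet> u \<le> \<kappa> * ((H *v u) \<bullet> u)"
  shows "(matrix_inv H *v w) \<bullet> w \<le> \<kappa> * ((matrix_inv P *v w) \<bullet> w)"
proof -
  let ?u = "matrix_inv H *v w"
  let ?X = "(matrix_inv H *v w) \<bullet> w" and ?Y = "(matrix_inv P *v w) \<bullet> w"
  have X: "0 \<le> ?X" and Y: "0 \<le> ?Y"
    using pos_def_nonneg pos_def_matrix_inv H P by blast+
  have "?X = \<bar>w \<bullet> ?u\<bar>" using X by (simp add: inner_commute)
  also have "\<dots> \<le> mnorm_dual P w * mnorm P ?u" by (rule inner_le_mnorm_dual[OF P])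
  finally have "?X\<^sup>2 \<le> (mnorm_dual P w * mnorm P ?u)\<^sup>2" using X by (rule power_mono)
  also have "\<dots> = ?Y * ((P *v ?u) \<bullet> ?u)"
    by (simp add: power_mult_distrib mnorm_square P pos_def_matrix_inv mnorm_dual_eq_mnorm_inv)
  also have "\<dots> \<le> ?Y * (\<kappa> * ((H *v ?u) \<bullet> ?u))"
    by (rule mult_left_mono[OF le Y])
  also have "\<dots> = \<kappa> * ?Y * ?X"
    by (simp add: pos_def_inv_right H inner_commute)
  finally have "?X * ?X \<le> (\<kappa> * ?Y) * ?X" by (simp add: power2_eq_square)
  then show ?thesis
    using X Y k by (cases "?X = 0") (simp_all add: mult_le_cancel_right)
qed

text \<open>Two metrics that bound each other up to the factor \<open>(1 - \<eta>)\<^sup>-\<^sup>2\<close> have inverses that do so too. The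
  upper deviation is then at most \<open>(1 - \<eta>)\<^sup>-\<^sup>2 - 1\<close> relative to the inverse of \<open>H\<close>, and the lower
  deviation is smaller still.\<close>

lemma inverse_metric_gap:
  assumes H: "pos_def H" and P: "pos_def P" and \<eta>: "0 \<le> \<eta>" "\<eta> < 1"
    and lo: "\<And>u. (1 - \<eta>)\<^sup>2 * ((H *v u) \<bullet> u) \<le> (P *v u) \<bullet> u"
    and up: "\<And>u. (P *v u) \<bullet> u \<le> (H *v u) \<bullet> u / (1 - \<eta>)\<^sup>2"
  shows "\<bar>((matrix_inv P - matrix_inv H) *v w) \<bullet> w\<bar> \<le> theta \<eta> * ((matrix_inv H *v w) \<bullet> w)"
proof -
  let ?X = "(matrix_inv H *v w) \<bullet> w" and ?Y = "(matrix_inv P *v w) \<bullet> w"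
  define k where "k = 1 / (1 - \<eta>)\<^sup>2"
  have "0 < (1 - \<eta>)\<^sup>2" "(1 - \<eta>)\<^sup>2 \<le> 1" using \<eta> by (auto intro!: power_le_one)
  then have k: "1 \<le> k" by (simp add: k_def)
  have X: "0 \<le> ?X" using pos_def_nonneg[OF pos_def_matrix_inv[OF H]] .
  have "(H *v u) \<bullet> u \<le> k * ((P *v u) \<bullet> u)" for u
    using lo[of u] \<eta> by (simp add: k_def pos_le_divide_eq mult.commute)
  then have a: "?Y \<le> k * ?X" using matrix_inv_antitone[OF P H, of k w] k by simp
  have "(P *v u) \<bullet> u \<le> k * ((H *v u) \<bullet> u)" for u using up[of u] by (simp add: k_def)
  then have b: "?X \<le> k * ?Y" using matrix_inv_antitone[OF H P, of k w] k by simp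
  have "?X - ?Y \<le> (k - 1) * ?X"
  proof (cases "?Y \<le> ?X")
    case True
    have "?X - ?Y \<le> (k - 1) * ?Y" using b by (simp add: algebra_simps)
    also have "\<dots> \<le> (k - 1) * ?X" using True k by (intro mult_left_mono) auto
    finally show ?thesis .
  next
    case False
    moreover have "0 \<le> (k - 1) * ?X" using k X by simp
    ultimately show ?thesis by linarith
  qed
  moreover have "?Y - ?X \<le> (k - 1) * ?X" using a by (simp add: algebra_simps)
  moreover have "theta \<eta> = k - 1" by (simp add: theta_def k_def)
  ultimately show ?thesis
    by (simp add: matrix_vector_mult_diff_rdistrib inner_diff_left abs_le_iff)
qed

lemma theta_nonneg: "0 \<le> \<eta> \<Longrightarrow> \<eta> < 1 \<Longrightarrow> 0 \<le> theta \<eta>"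
  using power_le_one[of "1 - \<eta>" 2] by (simp add: theta_def)

lemma form_bounds_le:
  assumes H: "pos_def H"
    and lo: "\<And>u. m * ((H *v u) \<bullet> u) \<le> (M *v u) \<bullet> u"
    and up: "\<And>u. (M *v u) \<bullet> u \<le> L * ((H *v u) \<bullet> u)"
  shows "m \<le> L"
proof -
  let ?u = "axis undefined (1::real)"
  have "?u \<noteq> 0" by (simp add: axis_eq_0_iff)
  then have "(H *v ?u) \<bullet> ?u > 0" using H by (simp add: pos_def_def)
  moreover have "m * ((H *v ?u) \<bullet> ?u) \<le> L * ((H *v ?u) \<bullet> ?u)"
    using lo[of ?u] up[of ?u] by linarith
  ultimately show ?thesis by simp
qed

text \<open>Linearized step. With the center metric as preconditioner, the error operator
  \<open>I - a H\<^sup>-\<^sup>1 M\<close> has \<open>H\<close>-norm at most \<open>1 - a m\<close>. Replacing \<open>H\<close> by the frozen metric \<open>P\<close> adds at most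
  \<open>a theta(\<eta>) L\<close>, and the smallness of the radius makes this at most a quarter of the gain \<open>a m\<close>.\<close>

lemma preconditioned_step_bound:
  assumes H: "pos_def H" and P: "pos_def P" and \<eta>: "0 \<le> \<eta>" "\<eta> < 1"
    and lo: "\<And>u. (1 - \<eta>)\<^sup>2 * ((H *v u) \<bullet> u) \<le> (P *v u) \<bullet> u"
    and up: "\<And>u. (P *v u) \<bullet> u \<le> (H *v u) \<bullet> u / (1 - \<eta>)\<^sup>2"
    and M: "self_adjoint M" and m: "0 < m" "theta \<eta> * L \<le> m / 4"
    and M_lo: "\<And>u. m * ((H *v u) \<bullet> u) \<le> (M *v u) \<bullet> u"
    and M_up: "\<And>u. (M *v u) \<bullet> u \<le> L * ((H *v u) \<bullet> u)"
    and a: "0 \<le> a" "a * L \<le> 1"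
  shows "\<bar>(H *v (e - a *\<^sub>R (matrix_inv P *v (M *v e)))) \<bullet> w\<bar>
           \<le> (1 - 3/4 * (a * m)) * mnorm H e * mnorm H w"
proof -
  have mL: "m \<le> L" by (rule form_bounds_le[OF H M_lo M_up])
  let ?S = "H - a *\<^sub>R M" and ?D = "matrix_inv P - matrix_inv H"
  have S: "self_adjoint ?S"
    by (intro self_adjoint_diff self_adjoint_scaleR pos_def_self_adjoint H M)
  have D: "self_adjoint ?D"
    by (intro self_adjoint_diff pos_def_self_adjoint pos_def_matrix_inv H P)
  have "\<bar>(?S *v u) \<bullet> u\<bar> \<le> (1 - a * m) * ((H *v u) \<bullet> u)" for u
  proof -
    have q: "0 \<le> (H *v u) \<bullet> u" by (rule pos_def_nonneg[OF H])
    have eq: "(?S *v u) \<bullet> u = (H *v u) \<bullet> u - a * ((M *v u) \<bullet> u)"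
      by (simp add: matrix_vector_mult_diff_rdistrib inner_diff_left
          flip: scaleR_matrix_vector_assoc)
    have "a * (m * ((H *v u) \<bullet> u)) \<le> a * ((M *v u) \<bullet> u)"
      by (rule mult_left_mono[OF M_lo a(1)])
    moreover have "a * ((M *v u) \<bullet> u) \<le> (a * L) * ((H *v u) \<bullet> u)"
      using mult_left_mono[OF M_up a(1)] by (simp add: mult.assoc)
    moreover have "(a * L) * ((H *v u) \<bullet> u) \<le> 1 * ((H *v u) \<bullet> u)"
      by (rule mult_right_mono[OF a(2) q])
    moreover have "(a * m) * ((H *v u) \<bullet> u) \<le> (a * L) * ((H *v u) \<bullet> u)"
      using mL a q by (intro mult_right_mono mult_left_mono) auto
    ultimately show ?thesis unfolding eq by (simp add: algebra_simps abs_le_iff)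
  qed
  from self_adjoint_bilinear_bound[OF H S this, of e w]
  have 1: "\<bar>(?S *v e) \<bullet> w\<bar> \<le> (1 - a * m) * mnorm H e * mnorm H w" .
  have "\<bar>(?D *v (M *v e)) \<bullet> (H *v w)\<bar> \<le> theta \<eta> * mnorm_dual H (M *v e) * mnorm H w"
    using self_adjoint_bilinear_bound[OF pos_def_matrix_inv[OF H] D
        inverse_metric_gap[OF H P \<eta> lo up], of "M *v e" "H *v w"]
    by (simp add: mnorm_dual_image[OF H] flip: mnorm_dual_eq_mnorm_inv)
  also have "\<dots> \<le> theta \<eta> * (L * mnorm H e) * mnorm H w"
  proof (intro mult_right_mono mult_left_mono mnorm_dual_le H M mnorm_nonneg theta_nonneg \<eta>)
    show "0 \<le> L" using m mL by simp
    show "\<bar>(M *v u) \<bullet> u\<bar> \<le> L * ((H *v u) \<bullet> u)" for u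
    proof -
      have "0 \<le> m * ((H *v u) \<bullet> u)" using m pos_def_nonneg[OF H, of u] by simp
      then show ?thesis using M_lo[of u] M_up[of u] by simp
    qed
  qed
  also have "\<dots> = (theta \<eta> * L) * (mnorm H e * mnorm H w)" by simp
  also have "\<dots> \<le> m / 4 * (mnorm H e * mnorm H w)"
    using m(2) by (intro mult_right_mono mult_nonneg_nonneg mnorm_nonneg H) auto
  finally have 2: "a * \<bar>(?D *v (M *v e)) \<bullet> (H *v w)\<bar> \<le> a * (m / 4 * (mnorm H e * mnorm H w))"
    using a(1) by (rule mult_left_mono)
  have "(H *v (e - a *\<^sub>R (matrix_inv P *v (M *v e)))) \<bullet> w
      = (?S *v e) \<bullet> w - a * ((?D *v (M *v e)) \<bullet> (H *v w))"
    by (simp add: self_adjointD[OF pos_def_self_adjoint[OF H], of _ w, symmetric]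
        matrix_vector_mult_diff_rdistrib matrix_vector_mult_diff_distrib inner_diff_left
        matrix_vector_mult_scaleR pos_def_inv_right[OF H] algebra_simps
        flip: scaleR_matrix_vector_assoc)
  then have "\<bar>(H *v (e - a *\<^sub>R (matrix_inv P *v (M *v e)))) \<bullet> w\<bar>
      \<le> \<bar>(?S *v e) \<bullet> w\<bar> + a * \<bar>(?D *v (M *v e)) \<bullet> (H *v w)\<bar>"
    using a by (simp add: abs_mult abs_triangle_ineq4[THEN order_trans])
  also have "\<dots> \<le> (1 - 3/4 * (a * m)) * mnorm H e * mnorm H w"
    using 1 2 by (simp add: algebra_simps)
  finally show ?thesis .
qed

section \<open>One preconditioned gradient step\<close>

lemma has_derivative_along_line:
  assumes "(F has_derivative D) (at (p + s *\<^sub>R v))"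
  shows "((\<lambda>s. F (p + s *\<^sub>R v)) has_derivative (\<lambda>\<tau>. D (\<tau> *\<^sub>R v))) (at s)"
proof -
  have "((\<lambda>s. p + s *\<^sub>R v) has_derivative (\<lambda>\<tau>. \<tau> *\<^sub>R v)) (at s)"
    by (auto intro!: derivative_eq_intros)
  from has_derivative_compose[OF this assms] show ?thesis .
qed

text \<open>The nonlinear step follows from the linearized one by the mean value theorem along the segment
  from the center \<open>c\<close>, where \<open>q\<close> vanishes, to \<open>w\<close>: tested against a vector, the step is a scalar function
  of the segment parameter whose derivative is the linearized step at an intermediate point.\<close>

lemma tracker_step:
  fixes q :: "real^'d \<Rightarrow> real^'d"
  assumes H: "pos_def H" and P: "pos_def P" and \<eta>: "0 \<le> \<eta>" "\<eta> < 1"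
    and lo: "\<And>u. (1 - \<eta>)\<^sup>2 * ((H *v u) \<bullet> u) \<le> (P *v u) \<bullet> u"
    and up: "\<And>u. (P *v u) \<bullet> u \<le> (H *v u) \<bullet> u / (1 - \<eta>)\<^sup>2"
    and m: "0 < m" "theta \<eta> * L \<le> m / 4" and a: "0 \<le> a" "a * L \<le> 1"
    and N: "convex N" "c \<in> N" "w \<in> N" and qc: "q c = 0"
    and der: "\<And>p. p \<in> N \<Longrightarrow> (q has_derivative (\<lambda>u. M p *v u)) (at p)"
    and M: "\<And>p. p \<in> N \<Longrightarrow> self_adjoint (M p)"
    and M_lo: "\<And>p u. p \<in> N \<Longrightarrow> m * ((H *v u) \<bullet> u) \<le> (M p *v u) \<bullet> u"
    and M_up: "\<And>p u. p \<in> N \<Longrightarrow> (M p *v u) \<bullet> u \<le> L * ((H *v u) \<bullet> u)"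
  shows "mnorm H (w - a *\<^sub>R (matrix_inv P *v q w) - c) \<le> (1 - 3/4 * (a * m)) * mnorm H (w - c)"
proof (rule mnorm_le_by_duality[OF H])
  let ?e = "w - c" and ?B = "(1 - 3/4 * (a * m)) * mnorm H (w - c)"
  have bd: "\<bar>(H *v (?e - a *\<^sub>R (matrix_inv P *v (M p *v ?e)))) \<bullet> u\<bar> \<le> ?B * mnorm H u"
    if "p \<in> N" for p u
    by (rule preconditioned_step_bound[OF H P \<eta> lo up M[OF that] m M_lo[OF that] M_up[OF that] a])
  show "0 \<le> ?B"
  proof (cases "?e = 0")
    case False
    have "0 \<le> ?B * mnorm H ?e" using bd[OF N(2), of ?e] by linarith
    then show ?thesis using mnorm_pos[OF H False] by (simp add: zero_le_mult_iff)
  qed (simp add: mnorm_def)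
  fix u
  define \<phi> where "\<phi> s = (H *v (s *\<^sub>R ?e - a *\<^sub>R (matrix_inv P *v q (c + s *\<^sub>R ?e)))) \<bullet> u" for s
  have seg: "c + s *\<^sub>R ?e \<in> N" if "s \<in> {0..1}" for s
    using convexD_alt[OF N, of s] that by (simp add: algebra_simps)
  define \<phi>' where "\<phi>' s t = (H *v (t *\<^sub>R ?e -
      a *\<^sub>R (matrix_inv P *v (M (c + s *\<^sub>R ?e) *v (t *\<^sub>R ?e))))) \<bullet> u" for s t
  have "(\<phi> has_derivative \<phi>' s) (at s within {0..1})" if s: "0 \<le> s" "s \<le> 1" for s
  proof -
    have "c + s *\<^sub>R ?e \<in> N" by (rule seg) (use s in simp)
    then have "((\<lambda>s. q (c + s *\<^sub>R ?e)) has_derivative (\<lambda>t. M (c + s *\<^sub>R ?e) *v (t *\<^sub>R ?e))) (at s)"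
      by (intro has_derivative_along_line der)
    from bounded_linear.has_derivative[OF matrix_vector_mul_bounded_linear[of "matrix_inv P"] this]
    have "((\<lambda>s. s *\<^sub>R ?e - a *\<^sub>R (matrix_inv P *v q (c + s *\<^sub>R ?e))) has_derivative
       (\<lambda>t. t *\<^sub>R ?e - a *\<^sub>R (matrix_inv P *v (M (c + s *\<^sub>R ?e) *v (t *\<^sub>R ?e))))) (at s)"
      by (intro has_derivative_diff has_derivative_scaleR_left has_derivative_scaleR_right
          has_derivative_ident)
    from bounded_linear.has_derivative[OF matrix_vector_mul_bounded_linear[of H] this]
    show ?thesis
      unfolding \<phi>_def[abs_def] \<phi>'_def[abs_def]
      by (rule has_derivative_at_withinI[OF has_derivative_inner_left])
  qed
  from mvt_simple[of 0 1 \<phi> \<phi>', OF _ this] obtain s where "s \<in> {0<..<1}"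
    and "\<phi> 1 - \<phi> 0 = (H *v (?e - a *\<^sub>R (matrix_inv P *v (M (c + s *\<^sub>R ?e) *v ?e)))) \<bullet> u"
    by (auto simp: \<phi>'_def)
  moreover have "\<phi> 0 = 0" by (simp add: \<phi>_def qc)
  moreover have "\<phi> 1 = (H *v (w - a *\<^sub>R (matrix_inv P *v q w) - c)) \<bullet> u"
    by (simp add: \<phi>_def algebra_simps)
  ultimately show "(H *v (w - a *\<^sub>R (matrix_inv P *v q w) - c)) \<bullet> u \<le> ?B * mnorm H u"
    using bd[OF seg[of s], of u] by auto
qed

section \<open>Gradients and symmetry of Hessians\<close>

lemma grad_eq: "GDERIV h p :> v \<Longrightarrow> grad h p = v"
proof -
  assume v: "GDERIV h p :> v"
  have "w = v" if "GDERIV h p :> w" for w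
  proof -
    have "(\<lambda>u. u \<bullet> w) = (\<lambda>u. u \<bullet> v)"
      using that v has_derivative_unique unfolding gderiv_def by blast
    then show ?thesis by (metis vector_eq_ldot inner_commute)
  qed
  with v show "grad h p = v" unfolding grad_def by blast
qed

lemma GDERIV_grad:
  fixes h :: "'a::euclidean_space \<Rightarrow> real"
  assumes "h differentiable (at p)"
  shows "GDERIV h p :> grad h p"
proof -
  obtain D where D: "(h has_derivative D) (at p)" using assms by (auto simp: differentiable_def)
  have "D u = u \<bullet> adjoint D 1" for u
    using adjoint_works[OF has_derivative_linear[OF D], of u 1] by simp
  then have "GDERIV h p :> adjoint D 1" using D unfolding gderiv_def by (metis ext)
  then show ?thesis using grad_eq by metis
qed

text \<open>The second difference of \<open>h\<close> over a small parallelogram is \<open>t\<^sup>2\<close> times the second derivative, up to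
  an arbitrarily small relative error: apply the mean value theorem in the direction \<open>v\<close> to the first
  difference in the direction \<open>u\<close>, then expand \<open>G\<close> at \<open>p\<close>.\<close>

lemma second_difference_estimate:
  fixes h :: "'a::euclidean_space \<Rightarrow> real"
  assumes G: "\<And>y. GDERIV h y :> G y" and D: "(G has_derivative D) (at p)" and e: "0 < e"
  shows "\<forall>\<^sub>F t in at_right 0. \<bar>(h (p + t *\<^sub>R u + t *\<^sub>R v) - h (p + t *\<^sub>R u) - h (p + t *\<^sub>R v) + h p)
           - t\<^sup>2 * (D u \<bullet> v)\<bar> \<le> t\<^sup>2 * (e * ((norm u + 2 * norm v) * norm v))"
proof -
  interpret D: bounded_linear D using D by (rule has_derivative_bounded_linear)
  obtain d where d: "0 < d" and
    est: "\<And>y. norm (y - p) < d \<Longrightarrow> norm (G y - G p - D (y - p)) \<le> e * norm (y - p)"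
    using D e unfolding has_derivative_at_alt by blast
  define K where "K = norm u + norm v + 1"
  have K: "0 < K" unfolding K_def using norm_ge_zero[of u] norm_ge_zero[of v] by linarith
  have "\<bar>(h (p + t *\<^sub>R u + t *\<^sub>R v) - h (p + t *\<^sub>R u) - h (p + t *\<^sub>R v) + h p)
           - t\<^sup>2 * (D u \<bullet> v)\<bar> \<le> t\<^sup>2 * (e * ((norm u + 2 * norm v) * norm v))"
    if t: "0 < t" "t < d / K" for t
  proof -
    define \<phi> where "\<phi> s = h (p + t *\<^sub>R u + s *\<^sub>R v) - h (p + s *\<^sub>R v)" for s
    have line: "((\<lambda>s. h (r + s *\<^sub>R v)) has_derivative (\<lambda>\<tau>. (\<tau> *\<^sub>R v) \<bullet> G (r + s *\<^sub>R v))) (at s)" for r s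
      using G by (intro has_derivative_along_line) (simp add: gderiv_def)
    have "(\<phi> has_derivative (\<lambda>\<tau>. (\<tau> *\<^sub>R v) \<bullet> G (p + t *\<^sub>R u + s *\<^sub>R v)
          - (\<tau> *\<^sub>R v) \<bullet> G (p + s *\<^sub>R v))) (at s within {0..t})" for s
      unfolding \<phi>_def[abs_def] by (rule has_derivative_at_withinI) (intro has_derivative_diff line)
    \<comment> \<open>The increment in the direction \<open>v\<close> of the difference in the direction \<open>u\<close>.\<close>
    from mvt_simple[of 0 t \<phi>, OF t(1) this] obtain s where s: "0 < s" "s < t"
      and eq: "\<phi> t - \<phi> 0 = t * (v \<bullet> G (p + t *\<^sub>R u + s *\<^sub>R v) - v \<bullet> G (p + s *\<^sub>R v))"
      by (auto simp: right_diff_distrib)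
    let ?y1 = "p + t *\<^sub>R u + s *\<^sub>R v" and ?y2 = "p + s *\<^sub>R v"
    have n1: "norm (?y1 - p) \<le> t * (norm u + norm v)"
    proof -
      have "norm (?y1 - p) \<le> t * norm u + s * norm v"
        using norm_triangle_ineq[of "t *\<^sub>R u" "s *\<^sub>R v"] s t by (simp add: algebra_simps)
      also have "\<dots> \<le> t * norm u + t * norm v" using s by (simp add: mult_right_mono)
      finally show ?thesis by (simp add: algebra_simps)
    qed
    have n2: "norm (?y2 - p) \<le> t * norm v" using s by (simp add: mult_right_mono)
    have tK: "t * K < d" using t K by (simp add: pos_less_divide_eq)
    have "t * (norm u + norm v) \<le> t * K" "t * norm v \<le> t * K"
      using t by (auto simp: K_def intro!: mult_left_mono)
    then have "norm (?y1 - p) < d" "norm (?y2 - p) < d" using n1 n2 tK by linarith+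
    then have r1: "norm (G ?y1 - G p - D (?y1 - p)) \<le> e * (t * (norm u + norm v))"
      and r2: "norm (G ?y2 - G p - D (?y2 - p)) \<le> e * (t * norm v)"
      using est[of ?y1] est[of ?y2] mult_left_mono[OF n1, of e] mult_left_mono[OF n2, of e] e
      by linarith+
    have "D (?y1 - p) = t *\<^sub>R D u + s *\<^sub>R D v" "D (?y2 - p) = s *\<^sub>R D v"
      by (simp_all add: D.add D.scaleR add.assoc)
    then have split: "G ?y1 - G ?y2 - t *\<^sub>R D u
        = (G ?y1 - G p - D (?y1 - p)) - (G ?y2 - G p - D (?y2 - p))"
      by (simp add: algebra_simps)
    have "norm (G ?y1 - G ?y2 - t *\<^sub>R D u) \<le> e * (t * (norm u + norm v)) + e * (t * norm v)"
      unfolding split using norm_triangle_ineq4[of "G ?y1 - G p - D (?y1 - p)" "G ?y2 - G p - D (?y2 - p)"] r1 r2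
      by linarith
    then have R: "norm (G ?y1 - G ?y2 - t *\<^sub>R D u) \<le> t * (e * (norm u + 2 * norm v))"
      by (simp add: algebra_simps)
    have "(h (p + t *\<^sub>R u + t *\<^sub>R v) - h (p + t *\<^sub>R u) - h (p + t *\<^sub>R v) + h p) - t\<^sup>2 * (D u \<bullet> v)
        = t * (v \<bullet> (G ?y1 - G ?y2 - t *\<^sub>R D u))"
      using eq by (simp add: \<phi>_def algebra_simps power2_eq_square inner_commute)
    also have "\<bar>\<dots>\<bar> \<le> t * (norm v * (t * (e * (norm u + 2 * norm v))))"
    proof -
      have "\<bar>v \<bullet> (G ?y1 - G ?y2 - t *\<^sub>R D u)\<bar> \<le> norm v * norm (G ?y1 - G ?y2 - t *\<^sub>R D u)"
        by (rule Cauchy_Schwarz_ineq2)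
      also have "\<dots> \<le> norm v * (t * (e * (norm u + 2 * norm v)))"
        by (rule mult_left_mono[OF R norm_ge_zero])
      finally show ?thesis using t by (simp add: abs_mult)
    qed
    finally show ?thesis by (simp add: power2_eq_square mult_ac)
  qed
  moreover have "0 < d / K" using d K by simp
  ultimately show ?thesis by (auto simp: eventually_at_right_field)
qed

text \<open>The second difference is symmetric in the two directions, hence so is its limit.\<close>

lemma second_derivative_symmetric:
  fixes h :: "'a::euclidean_space \<Rightarrow> real"
  assumes G: "\<And>y. GDERIV h y :> G y" and D: "(G has_derivative D) (at p)"
  shows "D u \<bullet> v = u \<bullet> D v"
proof -
  define C where "C = (norm u + 2 * norm v) * norm v + (norm v + 2 * norm u) * norm u"
  have le: "\<bar>D u \<bullet> v - D v \<bullet> u\<bar> \<le> e * C" if "0 < e" for e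
  proof -
    have "\<forall>\<^sub>F t in at_right (0::real). 0 < t \<and>
       \<bar>(h (p + t *\<^sub>R u + t *\<^sub>R v) - h (p + t *\<^sub>R u) - h (p + t *\<^sub>R v) + h p) - t\<^sup>2 * (D u \<bullet> v)\<bar>
         \<le> t\<^sup>2 * (e * ((norm u + 2 * norm v) * norm v)) \<and>
       \<bar>(h (p + t *\<^sub>R v + t *\<^sub>R u) - h (p + t *\<^sub>R v) - h (p + t *\<^sub>R u) + h p) - t\<^sup>2 * (D v \<bullet> u)\<bar>
         \<le> t\<^sup>2 * (e * ((norm v + 2 * norm u) * norm u))"
      by (intro eventually_conj eventually_at_right_less second_difference_estimate[OF G D that])
    then obtain t :: real where t: "0 < t" and
       "\<bar>(h (p + t *\<^sub>R u + t *\<^sub>R v) - h (p + t *\<^sub>R u) - h (p + t *\<^sub>R v) + h p) - t\<^sup>2 * (D u \<bullet> v)\<bar>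
         \<le> t\<^sup>2 * (e * ((norm u + 2 * norm v) * norm v))"
       "\<bar>(h (p + t *\<^sub>R v + t *\<^sub>R u) - h (p + t *\<^sub>R v) - h (p + t *\<^sub>R u) + h p) - t\<^sup>2 * (D v \<bullet> u)\<bar>
         \<le> t\<^sup>2 * (e * ((norm v + 2 * norm u) * norm u))"
      using eventually_happens'[OF trivial_limit_at_right_real] by blast
    moreover have "p + t *\<^sub>R v + t *\<^sub>R u = p + t *\<^sub>R u + t *\<^sub>R v" by (simp add: algebra_simps)
    ultimately have "\<bar>t\<^sup>2 * (D u \<bullet> v) - t\<^sup>2 * (D v \<bullet> u)\<bar>
        \<le> t\<^sup>2 * (e * ((norm u + 2 * norm v) * norm v)) + t\<^sup>2 * (e * ((norm v + 2 * norm u) * norm u))"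
      by (simp only: abs_le_iff) linarith
    then have "t\<^sup>2 * \<bar>D u \<bullet> v - D v \<bullet> u\<bar> \<le> t\<^sup>2 * (e * C)"
      by (simp add: C_def distrib_left abs_mult flip: right_diff_distrib)
    then show ?thesis using t by simp
  qed
  have "\<bar>D u \<bullet> v - D v \<bullet> u\<bar> \<le> 0"
  proof (rule field_le_epsilon)
    fix e :: real assume e: "0 < e"
    have "0 \<le> C" by (simp add: C_def)
    then have "e / (C + 1) * C \<le> e" using e by (simp add: divide_simps)
    moreover have "0 < e / (C + 1)" using e \<open>0 \<le> C\<close> by simp
    ultimately show "\<bar>D u \<bullet> v - D v \<bullet> u\<bar> \<le> 0 + e" using le[of "e / (C + 1)"] by linarith
  qed
  then show ?thesis by (simp add: inner_commute)
qed

lemma jacobian_mult: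
  fixes F :: "real^'a \<Rightarrow> real^'b"
  assumes "(F has_derivative D) (at p)" shows "jacobian F (at p) *v u = D u"
proof -
  have "frechet_derivative F (at p) = D" using frechet_derivative_at[OF assms] by simp
  then show ?thesis
    unfolding jacobian_def using has_derivative_linear[OF assms] by (simp add: matrix_works)
qed

lemma has_derivative_slice_snd:
  assumes "(F has_derivative D) (at (x, y))"
  shows "((\<lambda>y. F (x, y)) has_derivative (\<lambda>u. D (0, u))) (at y)"
  by (rule has_derivative_compose[of "\<lambda>y. (x, y)" "\<lambda>u. (0, u)", OF _ assms])
    (auto intro!: derivative_eq_intros)

lemma C2_GDERIV_slice:
  fixes h :: "(real^'n) \<times> (real^'d) \<Rightarrow> real"
  assumes "C2 h" shows "GDERIV (\<lambda>y. h (x, y)) y :> snd (grad h (x, y))"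
proof -
  have "GDERIV h (x, y) :> grad h (x, y)" using assms by (intro GDERIV_grad) (auto simp: C2_def)
  from has_derivative_slice_snd[OF this[unfolded gderiv_def]] show ?thesis
    by (simp add: gderiv_def inner_prod_def)
qed

lemma C2_grad_y_eq: "C2 h \<Longrightarrow> grad_y h x = (\<lambda>y. snd (grad h (x, y)))"
  unfolding grad_y_def by (intro ext grad_eq C2_GDERIV_slice)

lemma C2_GDERIV_grad_y: "C2 h \<Longrightarrow> GDERIV (\<lambda>y. h (x, y)) y :> grad_y h x y"
  using C2_GDERIV_slice[of h x y] by (simp add: C2_grad_y_eq)

lemma C2_grad_y_has_derivative:
  assumes h: "C2 h"
  shows "(grad_y h x has_derivative (\<lambda>u. hess_yy h x y *v u)) (at y)"
proof -
  obtain D where "(grad h has_derivative D) (at (x, y))"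
    using h unfolding C2_def differentiable_def by blast
  then have "grad_y h x differentiable (at y)"
    unfolding C2_grad_y_eq[OF h] differentiable_def
    by (auto intro!: exI has_derivative_snd has_derivative_slice_snd)
  moreover have "grad (\<lambda>y'. h (x, y')) = grad_y h x" by (simp add: grad_y_def fun_eq_iff)
  ultimately show ?thesis by (simp add: hess_yy_def hessian_def jacobian_works)
qed

lemma C2_hess_yy_self_adjoint: "C2 h \<Longrightarrow> self_adjoint (hess_yy h x y)"
  unfolding self_adjoint_def
  using second_derivative_symmetric[of "\<lambda>y. h (x, y)" "grad_y h x"]
    C2_GDERIV_grad_y C2_grad_y_has_derivative by blast

section \<open>Quadratic forms bounded by the local operator norm\<close>

text \<open>Bounds the unit sphere of the local norm, over which the local operator norm is a supremum.\<close>

lemma pos_def_coercive: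
  assumes H: "pos_def H"
  shows "(norm u)\<^sup>2 \<le> onorm ((*v) (matrix_inv H)) * (mnorm H u)\<^sup>2"
proof (cases "u = 0")
  case False
  let ?k = "onorm ((*v) (matrix_inv H))"
  have bl: "bounded_linear ((*v) (matrix_inv H))" by simp
  have "(mnorm_dual H u)\<^sup>2 = (matrix_inv H *v u) \<bullet> u"
    by (simp add: mnorm_dual_eq_mnorm_inv mnorm_square pos_def_matrix_inv H)
  also have "\<dots> \<le> norm (matrix_inv H *v u) * norm u" by (rule norm_cauchy_schwarz)
  also have "\<dots> \<le> ?k * norm u * norm u" by (intro mult_right_mono onorm[OF bl]) simp
  finally have d: "(mnorm_dual H u)\<^sup>2 \<le> ?k * (norm u)\<^sup>2" by (simp add: power2_eq_square mult.assoc)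
  have "(norm u)\<^sup>2 = \<bar>u \<bullet> u\<bar>" by (simp add: power2_norm_eq_inner)
  also have "\<dots> \<le> mnorm_dual H u * mnorm H u" by (rule inner_le_mnorm_dual[OF H])
  finally have "((norm u)\<^sup>2)\<^sup>2 \<le> (mnorm_dual H u)\<^sup>2 * (mnorm H u)\<^sup>2"
    by (metis power_mono power_mult_distrib zero_le_power2)
  also have "\<dots> \<le> ?k * (norm u)\<^sup>2 * (mnorm H u)\<^sup>2" by (rule mult_right_mono[OF d]) simp
  finally have "(norm u)\<^sup>2 * (norm u)\<^sup>2 \<le> (norm u)\<^sup>2 * (?k * (mnorm H u)\<^sup>2)"
    by (simp only: power2_eq_square mult_ac)
  then show ?thesis by (rule mult_left_le_imp_le) (use False in simp)
qed (simp add: onorm_pos_le)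

text \<open>A supremum of reals carries information only if it is taken over a nonempty set that is bounded
  above; both are checked here before the defining inequality is extracted from it.\<close>

lemma mnorm_dual_le_onorm_c_dual:
  assumes H: "pos_def H" shows "mnorm_dual H (M *v u) \<le> onorm_c_dual H M * mnorm H u"
proof (cases "u = 0")
  case False
  let ?k = "onorm ((*v) (matrix_inv H))"
  have bl: "bounded_linear ((*v) (matrix_inv H))" "bounded_linear ((*v) M)" by simp_all
  have "bdd_above ((\<lambda>u. mnorm_dual H (M *v u)) ` {u. mnorm H u = 1})"
  proof (rule bdd_aboveI2)
    fix v assume "v \<in> {u. mnorm H u = 1}"
    then have "(norm v)\<^sup>2 \<le> ?k" using pos_def_coercive[OF H, of v] by simp
    have "(mnorm_dual H (M *v v))\<^sup>2 = (matrix_inv H *v (M *v v)) \<bullet> (M *v v)"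
      by (simp add: mnorm_dual_eq_mnorm_inv mnorm_square pos_def_matrix_inv H)
    also have "\<dots> \<le> norm (matrix_inv H *v (M *v v)) * norm (M *v v)" by (rule norm_cauchy_schwarz)
    also have "\<dots> \<le> (?k * norm (M *v v)) * norm (M *v v)"
      by (intro mult_right_mono onorm[OF bl(1)]) simp
    also have "\<dots> = ?k * (norm (M *v v))\<^sup>2" by (simp add: power2_eq_square)
    also have "\<dots> \<le> ?k * (onorm ((*v) M) * norm v)\<^sup>2"
      by (intro mult_left_mono power_mono onorm[OF bl(2)] onorm_pos_le bl) simp
    also have "\<dots> \<le> ?k * ((onorm ((*v) M))\<^sup>2 * ?k)"
      unfolding power_mult_distrib
      by (intro mult_left_mono \<open>(norm v)\<^sup>2 \<le> ?k\<close> onorm_pos_le bl) simp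
    finally show "mnorm_dual H (M *v v) \<le> sqrt (?k * ((onorm ((*v) M))\<^sup>2 * ?k))"
      by (rule real_le_rsqrt)
  qed
  moreover define v where "v = (1 / mnorm H u) *\<^sub>R u"
  have p: "0 < mnorm H u" using mnorm_pos[OF H False] .
  then have "v \<in> {u. mnorm H u = 1}" by (simp add: v_def mnorm_scaleR)
  ultimately have "mnorm_dual H (M *v v) \<le> onorm_c_dual H M"
    unfolding onorm_c_dual_def by (intro cSUP_upper)
  moreover have "mnorm_dual H (M *v v) = mnorm_dual H (M *v u) / mnorm H u"
    using p by (simp add: v_def matrix_vector_mult_scaleR mnorm_dual_eq_mnorm_inv mnorm_scaleR)
  ultimately show ?thesis using p by (simp add: pos_divide_le_eq)
qed (simp add: mnorm_def mnorm_dual_def)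

lemma quadratic_form_le_onorm_c_dual:
  assumes H: "pos_def H" shows "\<bar>(M *v u) \<bullet> u\<bar> \<le> onorm_c_dual H M * ((H *v u) \<bullet> u)"
proof -
  have "\<bar>(M *v u) \<bullet> u\<bar> \<le> mnorm_dual H (M *v u) * mnorm H u" by (rule inner_le_mnorm_dual[OF H])
  also have "\<dots> \<le> onorm_c_dual H M * mnorm H u * mnorm H u"
    by (intro mult_right_mono mnorm_dual_le_onorm_c_dual mnorm_nonneg H)
  finally show ?thesis by (simp add: mnorm_square[OF H, symmetric] power2_eq_square mult.assoc)
qed

section \<open>The logarithmic barrier of a bounded polytope\<close>

abbreviation slack :: "real^'d^'m \<Rightarrow> real^'m \<Rightarrow> real^'d \<Rightarrow> 'm \<Rightarrow> real" where
  "slack A b y i \<equiv> b $ i - row i A \<bullet> y"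

lemma GDERIV_arg_min_zero:
  fixes h :: "'a::euclidean_space \<Rightarrow> real"
  assumes "is_arg_min h (\<lambda>y. y \<in> S) c" "open S" "GDERIV h c :> v"
  shows "v = 0"
proof -
  have "(\<lambda>u. u \<bullet> v) = (\<lambda>u. 0)"
    using assms by (intro differential_zero_maxmin[of c S h])
      (auto simp: is_arg_min_linorder gderiv_def)
  then have "v \<bullet> v = 0" by (rule fun_cong)
  then show ?thesis by simp
qed

locale bounded_polytope =
  fixes A :: "real^'d^'m" and b :: "real^'m"
  assumes compact_Y: "compact (Ypoly A b)" and interior_Y: "interior (Ypoly A b) \<noteq> {}"
begin

abbreviation Y where "Y \<equiv> Ypoly A b"

text \<open>A zero row of \<open>A\<close> bounds nothing, and its slack, a constant, may be zero. Hence strict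
  inequalities characterize interior points only for the nonzero rows; in the barrier the other rows
  contribute constants.\<close>

lemma interior_eq: "interior Y = {y. \<forall>i. row i A \<noteq> 0 \<longrightarrow> 0 < slack A b y i}" (is "_ = ?S")
proof
  show "interior Y \<subseteq> ?S"
  proof clarify
    fix y i assume y: "y \<in> interior Y" and i: "row i A \<noteq> 0"
    obtain e where e: "e > 0" "ball y e \<subseteq> Y" using y by (auto simp: mem_interior)
    define t where "t = e / (2 * norm (row i A))"
    have t: "t > 0" using e i by (simp add: t_def)
    have "y + t *\<^sub>R row i A \<in> ball y e" using e i by (simp add: t_def dist_norm)
    then have "row i A \<bullet> (y + t *\<^sub>R row i A) \<le> b $ i" using e by (auto simp: Ypoly_def)
    moreover have "t * (row i A \<bullet> row i A) > 0" using t i by simp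
    ultimately show "0 < slack A b y i" by (simp add: inner_add_right)
  qed
  have "?S = (\<Inter>i\<in>{i. row i A \<noteq> 0}. {y. row i A \<bullet> y < b $ i})" by auto
  then have "open ?S" by (auto intro!: open_INT open_halfspace_lt)
  moreover have "?S \<subseteq> Y"
  proof -
    obtain y0 where "y0 \<in> Y" using interior_Y interior_subset by blast
    then have "row i A \<bullet> y0 \<le> b $ i" for i by (simp add: Ypoly_def)
    then have zero_row: "0 \<le> b $ i" if "row i A = 0" for i using that by (metis inner_zero_left)
    have "row i A \<bullet> y \<le> b $ i" if "y \<in> ?S" for y i
      using that zero_row[of i] by (cases "row i A = 0") (auto intro: less_imp_le)
    then show ?thesis by (auto simp: Ypoly_def)
  qed
  ultimately show "?S \<subseteq> interior Y" by (simp add: interior_maximal)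
qed

lemma convex_Y: "convex Y"
proof -
  have "Y = (\<Inter>i. {y. row i A \<bullet> y \<le> b $ i})" by (auto simp: Ypoly_def)
  then show ?thesis by (auto intro!: convex_INT convex_halfspace_le)
qed

lemma barrier_GDERIV:
  assumes y: "y \<in> interior Y"
  shows "GDERIV (barrier A b) y :> (\<Sum>i\<in>UNIV. (1 / slack A b y i) *\<^sub>R row i A)"
proof -
  have "((\<lambda>y. ln (slack A b y i)) has_derivative (\<lambda>u. u \<bullet> (- (1 / slack A b y i) *\<^sub>R row i A))) (at y)" for i
  proof (cases "row i A = 0")
    case False
    then have "0 < slack A b y i" using y by (simp add: interior_eq)
    then show ?thesis
      by (auto intro!: derivative_eq_intros simp: inner_commute divide_simps)
  qed simp
  from has_derivative_minus[OF has_derivative_sum[OF this]]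
  show ?thesis
    unfolding gderiv_def barrier_def by (simp add: inner_sum_right sum_negf)
qed

lemma barrier_gradient_has_derivative:
  assumes y: "y \<in> interior Y"
  shows "(grad (barrier A b) has_derivative
    (\<lambda>u. \<Sum>i\<in>UNIV. ((row i A \<bullet> u) / (slack A b y i)\<^sup>2) *\<^sub>R row i A)) (at y)"
proof -
  have "((\<lambda>y. (1 / slack A b y i) *\<^sub>R row i A) has_derivative
      (\<lambda>u. ((row i A \<bullet> u) / (slack A b y i)\<^sup>2) *\<^sub>R row i A)) (at y)" for i
  proof (cases "row i A = 0")
    case False
    then have "slack A b y i \<noteq> 0" using y by (force simp: interior_eq)
    then have "((\<lambda>y. 1 / slack A b y i) has_derivative (\<lambda>u. (row i A \<bullet> u) / (slack A b y i)\<^sup>2)) (at y)"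
      by (auto intro!: derivative_eq_intros simp: power2_eq_square divide_simps)
    then show ?thesis by (rule has_derivative_scaleR_left)
  qed simp
  then have "((\<lambda>y. \<Sum>i\<in>UNIV. (1 / slack A b y i) *\<^sub>R row i A) has_derivative
      (\<lambda>u. \<Sum>i\<in>UNIV. ((row i A \<bullet> u) / (slack A b y i)\<^sup>2) *\<^sub>R row i A)) (at y)"
    by (rule has_derivative_sum)
  then show ?thesis
    by (rule has_derivative_transform_within_open[OF _ open_interior y])
      (simp add: grad_eq[OF barrier_GDERIV])
qed

lemma barrier_gradient_has_derivative_hess:
  assumes "y \<in> interior Y"
  shows "(grad (barrier A b) has_derivative (\<lambda>u. barrier_hess A b y *v u)) (at y)"
  using barrier_gradient_has_derivative[OF assms]
  unfolding barrier_hess_def hessian_def jacobian_works[symmetric] differentiable_def by blast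

lemma barrier_hess_form:
  assumes "y \<in> interior Y"
  shows "(barrier_hess A b y *v u) \<bullet> v
    = (\<Sum>i\<in>UNIV. (row i A \<bullet> u) * (row i A \<bullet> v) / (slack A b y i)\<^sup>2)"
proof -
  have "barrier_hess A b y *v u = (\<Sum>i\<in>UNIV. ((row i A \<bullet> u) / (slack A b y i)\<^sup>2) *\<^sub>R row i A)"
    using has_derivative_unique[OF barrier_gradient_has_derivative_hess[OF assms]
        barrier_gradient_has_derivative[OF assms]] by (rule fun_cong)
  then show ?thesis by (simp add: inner_sum_left)
qed

lemma barrier_hess_self_adjoint: "y \<in> interior Y \<Longrightarrow> self_adjoint (barrier_hess A b y)"
  by (simp add: self_adjoint_def barrier_hess_form inner_commute[of _ "barrier_hess A b y *v _"]
      mult.commute)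

text \<open>Each slack is, up to normalization, one coordinate of the Dikin metric, because the barrier
  Hessian is a sum of rank-one squares. All self-concordance estimates below reduce to this one.\<close>

lemma row_le_Dikin_norm:
  assumes c: "c \<in> interior Y" and i: "row i A \<noteq> 0"
  shows "\<bar>row i A \<bullet> u\<bar> \<le> mnorm (barrier_hess A b c) u * slack A b c i"
proof -
  have s: "0 < slack A b c i" using c i by (simp add: interior_eq)
  have "(row i A \<bullet> u) * (row i A \<bullet> u) / (slack A b c i)\<^sup>2 \<le> (barrier_hess A b c *v u) \<bullet> u"
    unfolding barrier_hess_form[OF c] by (rule member_le_sum) auto
  then have "(\<bar>row i A \<bullet> u\<bar> / slack A b c i)\<^sup>2 \<le> (barrier_hess A b c *v u) \<bullet> u"
    by (simp add: power_divide power2_eq_square)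
  then have "\<bar>row i A \<bullet> u\<bar> / slack A b c i \<le> mnorm (barrier_hess A b c) u"
    unfolding mnorm_def by (rule real_le_rsqrt)
  then show ?thesis using s by (simp add: pos_divide_le_eq)
qed

text \<open>A null direction of the Hessian is orthogonal to every row, so a whole line in that direction
  would lie in the polytope, against boundedness.\<close>

lemma pos_def_barrier_hess:
  assumes c: "c \<in> interior Y" shows "pos_def (barrier_hess A b c)"
  unfolding pos_def_def
proof (intro conjI allI impI barrier_hess_self_adjoint c)
  fix u :: "real^'d" assume u: "u \<noteq> 0"
  have nn: "0 \<le> (barrier_hess A b c *v u) \<bullet> u"
    unfolding barrier_hess_form[OF c] by (intro sum_nonneg) auto
  moreover have False if z: "(barrier_hess A b c *v u) \<bullet> u = 0"
  proof -
    have "row i A \<bullet> u = 0" for i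
      using row_le_Dikin_norm[OF c, of i u] z by (cases "row i A = 0") (auto simp: mnorm_def)
    then have "c + t *\<^sub>R u \<in> Y" for t
      using c interior_subset[of Y] by (auto simp: Ypoly_def inner_add_right)
    moreover obtain B where B: "\<And>y. y \<in> Y \<Longrightarrow> norm y \<le> B"
      using compact_imp_bounded[OF compact_Y] by (auto simp: bounded_iff)
    ultimately have "norm (c + ((B + norm c + 1) / norm u) *\<^sub>R u) \<le> B" by blast
    moreover have "norm (((B + norm c + 1) / norm u) *\<^sub>R u)
        \<le> norm (c + ((B + norm c + 1) / norm u) *\<^sub>R u) + norm c"
      using norm_triangle_ineq4[of "c + ((B + norm c + 1) / norm u) *\<^sub>R u" c] by simp
    moreover have "norm (((B + norm c + 1) / norm u) *\<^sub>R u) = \<bar>B + norm c + 1\<bar>" using u by simp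
    ultimately show False by linarith
  qed
  ultimately show "0 < (barrier_hess A b c *v u) \<bullet> u" by force
qed

lemma Dikin_slack:
  assumes c: "c \<in> interior Y" and r: "mnorm (barrier_hess A b c) (y - c) \<le> r" and i: "row i A \<noteq> 0"
  shows "(1 - r) * slack A b c i \<le> slack A b y i" "slack A b y i \<le> (1 + r) * slack A b c i"
proof -
  have "0 < slack A b c i" using c i by (simp add: interior_eq)
  then have "mnorm (barrier_hess A b c) (y - c) * slack A b c i \<le> r * slack A b c i"
    using r by (simp add: mult_right_mono)
  then have "\<bar>row i A \<bullet> (y - c)\<bar> \<le> r * slack A b c i"
    using row_le_Dikin_norm[OF c i, of "y - c"] by linarith
  moreover have "row i A \<bullet> (y - c) = slack A b c i - slack A b y i"
    by (simp add: inner_diff_right)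
  ultimately show "(1 - r) * slack A b c i \<le> slack A b y i"
    "slack A b y i \<le> (1 + r) * slack A b c i"
    by (simp_all add: abs_le_iff algebra_simps)
qed

lemma Dikin_ellipsoid_subset_interior:
  assumes c: "c \<in> interior Y" and r: "mnorm (barrier_hess A b c) (y - c) \<le> r" "r < 1"
  shows "y \<in> interior Y"
  unfolding interior_eq
proof clarify
  fix i assume i: "row i A \<noteq> 0"
  then have "0 < (1 - r) * slack A b c i" using c r by (simp add: interior_eq)
  with Dikin_slack(1)[OF c r(1) i] show "0 < slack A b y i" by linarith
qed

lemma mem_dikin_ball:
  assumes "c \<in> interior Y" "r < 1"
  shows "y \<in> dikin_ball A b r c \<longleftrightarrow> mnorm (barrier_hess A b c) (y - c) \<le> r"
  using Dikin_ellipsoid_subset_interior[OF assms(1) _ assms(2)] by (auto simp: dikin_ball_def)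

text \<open>Within local distance \<open>r\<close> every slack changes by a factor between \<open>1 - r\<close> and \<open>1 + r \<le> 1/(1 - r)\<close>,
  and the two Hessians are the same sum of squares with the slacks exchanged.\<close>

lemma Dikin_metric_comparison:
  assumes c: "c \<in> interior Y" and r: "mnorm (barrier_hess A b c) (y - c) \<le> r" "r < 1"
  shows "(1 - r)\<^sup>2 * ((barrier_hess A b c *v u) \<bullet> u) \<le> (barrier_hess A b y *v u) \<bullet> u" (is ?lo)
    and "(barrier_hess A b y *v u) \<bullet> u \<le> (barrier_hess A b c *v u) \<bullet> u / (1 - r)\<^sup>2" (is ?up)
proof -
  have y: "y \<in> interior Y" by (rule Dikin_ellipsoid_subset_interior[OF c r])
  have r0: "0 \<le> r" using r mnorm_nonneg[OF pos_def_barrier_hess[OF c], of "y - c"] by linarith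
  have "(1 - r)\<^sup>2 * ((row i A \<bullet> u)\<^sup>2 / (slack A b c i)\<^sup>2) \<le> (row i A \<bullet> u)\<^sup>2 / (slack A b y i)\<^sup>2 \<and>
      (row i A \<bullet> u)\<^sup>2 / (slack A b y i)\<^sup>2 \<le> (row i A \<bullet> u)\<^sup>2 / (slack A b c i)\<^sup>2 / (1 - r)\<^sup>2" for i
  proof (cases "row i A = 0")
    case False
    let ?s = "slack A b c i" and ?t = "slack A b y i"
    have s: "0 < ?s" and t: "0 < ?t" using c y False by (simp_all add: interior_eq)
    have a1: "(1 - r) * ?s \<le> ?t" using Dikin_slack(1)[OF c r(1) False] .
    have "(1 - r) * ?t \<le> (1 - r) * ((1 + r) * ?s)"
      using Dikin_slack(2)[OF c r(1) False] r by (intro mult_left_mono) auto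
    also have "\<dots> = ?s - r\<^sup>2 * ?s" by (simp add: algebra_simps power2_eq_square)
    also have "\<dots> \<le> ?s" using s by simp
    finally have a2: "(1 - r) * ?t \<le> ?s" .
    have "(1 - r)\<^sup>2 * ?s\<^sup>2 \<le> ?t\<^sup>2" "(1 - r)\<^sup>2 * ?t\<^sup>2 \<le> ?s\<^sup>2"
      unfolding power_mult_distrib[symmetric] using a1 a2 s t r by (auto intro!: power_mono)
    then have "(1 - r)\<^sup>2 / ?s\<^sup>2 \<le> 1 / ?t\<^sup>2" "1 / ?t\<^sup>2 \<le> 1 / ?s\<^sup>2 / (1 - r)\<^sup>2"
      using s t r by (simp_all add: divide_simps mult.commute)
    from this[THEN mult_left_mono, of "(row i A \<bullet> u)\<^sup>2"] show ?thesis by (simp add: mult.commute)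
  qed simp
  note * = this
  show ?lo ?up
    unfolding barrier_hess_form[OF c] barrier_hess_form[OF y] sum_distrib_left sum_divide_distrib
    using * by (auto intro!: sum_mono simp flip: power2_eq_square)
qed

text \<open>Moving the center by \<open>s\<close> costs \<open>s\<close> in distance and the factor \<open>1/(1 - s)\<close> for the change of metric.\<close>

lemma recenter:
  assumes c: "c \<in> interior Y" and s: "mnorm (barrier_hess A b c) (c' - c) \<le> s" "s < 1"
    and r: "mnorm (barrier_hess A b c) (w - c) \<le> r"
  shows "mnorm (barrier_hess A b c') (w - c') \<le> (r + s) / (1 - s)"
proof -
  let ?H = "barrier_hess A b c" and ?H' = "barrier_hess A b c'"
  have H: "pos_def ?H" and H': "pos_def ?H'"
    using pos_def_barrier_hess c Dikin_ellipsoid_subset_interior[OF c s] by blast+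
  have "(mnorm ?H' (w - c'))\<^sup>2 \<le> (mnorm ?H (w - c') / (1 - s))\<^sup>2"
    using Dikin_metric_comparison(2)[OF c s] by (simp add: mnorm_square H H' power_divide)
  then have "mnorm ?H' (w - c') \<le> mnorm ?H (w - c') / (1 - s)"
    by (rule power2_le_imp_le) (use s H in \<open>simp add: mnorm_nonneg\<close>)
  moreover have "mnorm ?H (w - c') \<le> r + s"
  proof -
    have "mnorm ?H ((w - c) + (- 1) *\<^sub>R (c' - c)) \<le> mnorm ?H (w - c) + mnorm ?H ((- 1) *\<^sub>R (c' - c))"
      by (rule mnorm_triangle[OF H])
    then show ?thesis using r s unfolding mnorm_scaleR by simp
  qed
  ultimately show ?thesis
    using s by (meson divide_right_mono diff_ge_0_iff_ge less_imp_le order_trans)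
qed

lemma convex_dikin_ball:
  assumes c: "c \<in> interior Y" shows "convex (dikin_ball A b r c)"
proof (rule convexI)
  let ?H = "barrier_hess A b c"
  fix u v :: "real^'d" and s t :: real
  assume u: "u \<in> dikin_ball A b r c" and v: "v \<in> dikin_ball A b r c"
    and st: "0 \<le> s" "0 \<le> t" "s + t = 1"
  have "s *\<^sub>R u + t *\<^sub>R v \<in> interior Y"
    using u v st convex_Y by (intro convexD convex_interior) (auto simp: dikin_ball_def)
  moreover have "s *\<^sub>R u + t *\<^sub>R v - c = s *\<^sub>R (u - c) + t *\<^sub>R (v - c)"
    using st(3) by (simp add: algebra_simps flip: scaleR_add_left)
  then have "mnorm ?H (s *\<^sub>R u + t *\<^sub>R v - c) \<le> s * mnorm ?H (u - c) + t * mnorm ?H (v - c)"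
    using mnorm_triangle[OF pos_def_barrier_hess[OF c], of "s *\<^sub>R (u - c)" "t *\<^sub>R (v - c)"] st
    by (simp add: mnorm_scaleR)
  moreover have "s * mnorm ?H (u - c) + t * mnorm ?H (v - c) \<le> r"
    using u v st by (intro convex_bound_le) (auto simp: dikin_ball_def)
  ultimately show "s *\<^sub>R u + t *\<^sub>R v \<in> dikin_ball A b r c" by (simp add: dikin_ball_def)
qed

section \<open>The barrier-regularized objective and its minimizers\<close>

lemma psi_GDERIV:
  assumes g: "C2 g" and y: "y \<in> interior Y"
  shows "GDERIV (\<lambda>y. psi A b g \<mu> (x, y)) y :> grad_y g x y + \<mu> *\<^sub>R grad (barrier A b) y"
proof -
  have "GDERIV (barrier A b) y :> grad (barrier A b) y"
    using barrier_GDERIV[OF y] by (simp add: grad_eq[OF barrier_GDERIV[OF y]])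
  then show ?thesis
    unfolding gderiv_def psi_def inner_add_right inner_scaleR_right snd_conv
    by (intro has_derivative_add has_derivative_mult_right C2_GDERIV_grad_y[OF g, unfolded gderiv_def])
qed

lemma psi_GDERIV_grad_y:
  assumes "C2 g" "y \<in> interior Y"
  shows "GDERIV (\<lambda>y. psi A b g \<mu> (x, y)) y :> grad_y (psi A b g \<mu>) x y"
  using psi_GDERIV[OF assms, of \<mu> x]
  by (simp add: grad_y_def[of "psi A b g \<mu>"] grad_eq[OF psi_GDERIV[OF assms]])

lemma psi_grad_y_has_derivative_aux:
  assumes g: "C2 g" and y: "y \<in> interior Y"
  shows "(grad_y (psi A b g \<mu>) x has_derivative
    (\<lambda>u. (hess_yy g x y + \<mu> *\<^sub>R barrier_hess A b y) *v u)) (at y)"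
proof (rule has_derivative_transform_within_open[OF _ open_interior y])
  show "((\<lambda>y. grad_y g x y + \<mu> *\<^sub>R grad (barrier A b) y) has_derivative
      (\<lambda>u. (hess_yy g x y + \<mu> *\<^sub>R barrier_hess A b y) *v u)) (at y)"
    unfolding matrix_vector_mult_add_rdistrib scaleR_matrix_vector_assoc[symmetric]
    by (intro has_derivative_add has_derivative_scaleR_right C2_grad_y_has_derivative g
        barrier_gradient_has_derivative_hess y)
  show "grad_y g x y + \<mu> *\<^sub>R grad (barrier A b) y = grad_y (psi A b g \<mu>) x y"
    if "y \<in> interior Y" for y
    using grad_eq[OF psi_GDERIV[OF g that]] by (simp add: grad_y_def)
qed

lemma psi_hess_yy:
  assumes "C2 g" "y \<in> interior Y"
  shows "hess_yy (psi A b g \<mu>) x y = hess_yy g x y + \<mu> *\<^sub>R barrier_hess A b y"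
proof -
  have "grad (\<lambda>y'. psi A b g \<mu> (x, y')) = grad_y (psi A b g \<mu>) x" by (simp add: grad_y_def fun_eq_iff)
  then show ?thesis
    using jacobian_mult[OF psi_grad_y_has_derivative_aux[OF assms]]
    by (simp add: hess_yy_def hessian_def matrix_eq)
qed

lemma psi_grad_y_has_derivative:
  assumes "C2 g" "y \<in> interior Y"
  shows "(grad_y (psi A b g \<mu>) x has_derivative (\<lambda>u. hess_yy (psi A b g \<mu>) x y *v u)) (at y)"
  unfolding psi_hess_yy[OF assms] by (rule psi_grad_y_has_derivative_aux[OF assms])

lemma psi_hess_yy_self_adjoint:
  assumes "C2 g" "y \<in> interior Y" shows "self_adjoint (hess_yy (psi A b g \<mu>) x y)"
  unfolding psi_hess_yy[OF assms]
  by (intro self_adjoint_add self_adjoint_scaleR C2_hess_yy_self_adjoint barrier_hess_self_adjoint assms)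

text \<open>The center is a choice among minimizers, so that a minimizer must be shown to exist. On the
  sublevel set of a fixed interior point the barrier is bounded above; as all slacks are bounded above on the
  compact polytope, no single logarithm can then be very negative. The sublevel set therefore lies in
  a compact subset of the interior, on which the minimum is attained.\<close>

lemma y_mu_is_arg_min:
  assumes g: "C2 g" and \<mu>: "0 < \<mu>"
  shows "is_arg_min (\<lambda>y. psi A b g \<mu> (x, y)) (\<lambda>y. y \<in> interior Y) (y_mu A b g \<mu> x)"
proof -
  let ?\<psi> = "\<lambda>y. psi A b g \<mu> (x, y)"
  have cont_g: "continuous_on S (\<lambda>y. g (x, y))" for S
    using C2_GDERIV_grad_y[OF g, of x]
    by (auto simp: gderiv_def intro!: continuous_at_imp_continuous_on has_derivative_continuous)
  have cont_psi: "continuous_on (interior Y) ?\<psi>"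
    using psi_GDERIV[OF g, of _ \<mu> x]
    by (auto simp: gderiv_def intro!: continuous_at_imp_continuous_on has_derivative_continuous)
  obtain y0 where y0: "y0 \<in> interior Y" using interior_Y by blast
  obtain ym where ym: "ym \<in> Y" "\<And>y. y \<in> Y \<Longrightarrow> g (x, ym) \<le> g (x, y)"
    using continuous_attains_inf[OF compact_Y _ cont_g] y0 interior_subset by blast
  obtain B where B: "\<And>y. y \<in> Y \<Longrightarrow> norm y \<le> B"
    using compact_imp_bounded[OF compact_Y] by (auto simp: bounded_iff)
  \<comment> \<open>The summand \<open>1\<close> makes \<open>ln S\<close> nonnegative, so that it also bounds the value \<open>ln 0 = 0\<close> of a zero row.\<close>
  define S where "S = 1 + (\<Sum>i\<in>UNIV. \<bar>b $ i\<bar> + norm (row i A) * B)"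
  have B0: "0 \<le> B" using B[OF ym(1)] norm_ge_zero order_trans by blast
  have slack_le: "slack A b y i \<le> S" if "y \<in> Y" for y i
  proof -
    have "slack A b y i \<le> \<bar>b $ i\<bar> + norm (row i A) * norm y"
      using Cauchy_Schwarz_ineq2[of "row i A" y] by linarith
    also have "\<dots> \<le> \<bar>b $ i\<bar> + norm (row i A) * B" using B[OF that] by (simp add: mult_left_mono)
    also have "\<dots> \<le> (\<Sum>i\<in>UNIV. \<bar>b $ i\<bar> + norm (row i A) * B)"
      using B0 by (intro member_le_sum) auto
    finally show ?thesis by (simp add: S_def)
  qed
  have S1: "1 \<le> S" using B0 by (simp add: S_def sum_nonneg)
  have ln_le: "ln (slack A b y i) \<le> ln S" if "y \<in> Y" for y i
  proof -
    have "0 \<le> slack A b y i" using that by (simp add: Ypoly_def)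
    then show ?thesis using slack_le[OF that, of i] S1
      by (cases "slack A b y i = 0") (auto simp: ln_mono)
  qed
  define C where "C = (?\<psi> y0 - g (x, ym)) / \<mu> + real CARD('m) * ln S"
  have slack_ge: "exp (- C) \<le> slack A b y i"
    if y: "y \<in> interior Y" and le: "?\<psi> y \<le> ?\<psi> y0" and i: "row i A \<noteq> 0" for y i
  proof -
    have yY: "y \<in> Y" using y interior_subset by blast
    have "barrier A b y = - ln (slack A b y i) - (\<Sum>j\<in>UNIV - {i}. ln (slack A b y j))"
      by (simp add: barrier_def sum.remove[of UNIV i])
    moreover have "(\<Sum>j\<in>UNIV - {i}. ln (slack A b y j)) \<le> (\<Sum>j\<in>UNIV - {i}. ln S)"
      by (intro sum_mono ln_le yY)
    moreover have "(\<Sum>j\<in>UNIV - {i}. ln S) \<le> real CARD('m) * ln S"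
      using S1 by (simp add: mult_right_mono)
    moreover have "barrier A b y \<le> (?\<psi> y0 - g (x, ym)) / \<mu>"
      using le ym(2)[OF yY] \<mu> by (simp add: psi_def pos_le_divide_eq mult.commute)
    ultimately have "- C \<le> ln (slack A b y i)" by (simp add: C_def)
    moreover have "0 < slack A b y i" using y i by (simp add: interior_eq)
    ultimately show ?thesis by (metis exp_le_cancel_iff exp_ln)
  qed
  define Z where "Z = Y \<inter> (\<Inter>i\<in>{i. row i A \<noteq> 0}. {y. exp (- C) \<le> slack A b y i})"
  have "closed {y. exp (- C) \<le> slack A b y i}" for i
    by (intro closed_Collect_le continuous_intros)
  then have "compact Z" unfolding Z_def by (intro compact_Int_closed compact_Y closed_INT) auto
  moreover have ZY: "Z \<subseteq> interior Y"
  proof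
    fix y assume "y \<in> Z"
    then have "exp (- C) \<le> slack A b y i" if "row i A \<noteq> 0" for i using that by (simp add: Z_def)
    then have "0 < slack A b y i" if "row i A \<noteq> 0" for i
      using that exp_gt_zero[of "- C"] less_le_trans by blast
    then show "y \<in> interior Y" by (simp add: interior_eq)
  qed
  moreover have inZ: "y \<in> Z" if "y \<in> interior Y" "?\<psi> y \<le> ?\<psi> y0" for y
    using slack_ge[OF that] that(1) interior_subset[of Y] by (auto simp: Z_def)
  ultimately obtain ys where ys: "ys \<in> Z" "\<And>y. y \<in> Z \<Longrightarrow> ?\<psi> ys \<le> ?\<psi> y"
    using continuous_attains_inf[of Z ?\<psi>] continuous_on_subset[OF cont_psi ZY] y0 by blast
  have "?\<psi> ys \<le> ?\<psi> y" if "y \<in> interior Y" for y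
    using ys(2)[OF inZ[OF that]] ys(2)[OF inZ[OF y0]] by fastforce
  then have "is_arg_min ?\<psi> (\<lambda>y. y \<in> interior Y) ys" using ys ZY by (auto simp: is_arg_min_linorder)
  then show ?thesis unfolding y_mu_def arg_min_on_def arg_min_def by (rule someI)
qed

lemma y_mu_stationary:
  assumes g: "C2 g" and \<mu>: "0 < \<mu>"
  shows y_mu_interior: "y_mu A b g \<mu> x \<in> interior Y"
    and "grad_y (psi A b g \<mu>) x (y_mu A b g \<mu> x) = 0"
proof -
  show i: "y_mu A b g \<mu> x \<in> interior Y"
    using y_mu_is_arg_min[OF assms] by (simp add: is_arg_min_def)
  show "grad_y (psi A b g \<mu>) x (y_mu A b g \<mu> x) = 0"
    by (rule GDERIV_arg_min_zero[OF y_mu_is_arg_min[OF assms] open_interior psi_GDERIV_grad_y[OF g i]])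
qed

lemma ylam_stationary:
  assumes f: "C2 f" and g: "C2 g" and sel: "penalized_selection A b f g \<mu> ylam" and l: "0 < l"
  shows ylam_interior: "ylam l x \<in> interior Y"
    and "grad_y f x (ylam l x) + l *\<^sub>R grad_y (psi A b g \<mu>) x (ylam l x) = 0"
proof -
  have m: "is_arg_min (lagr A b f g \<mu> l x) (\<lambda>y. y \<in> interior Y) (ylam l x)"
    using sel l by (simp add: penalized_selection_def)
  then show i: "ylam l x \<in> interior Y" by (simp add: is_arg_min_def)
  have "GDERIV (lagr A b f g \<mu> l x) (ylam l x) :>
      grad_y f x (ylam l x) + l *\<^sub>R grad_y (psi A b g \<mu>) x (ylam l x)"
    unfolding gderiv_def lagr_def inner_add_right inner_scaleR_right
    by (intro has_derivative_add has_derivative_mult_right C2_GDERIV_grad_y[OF f, unfolded gderiv_def]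
        has_derivative_diff[where g' = "\<lambda>_. 0", simplified] has_derivative_const
        psi_GDERIV_grad_y[OF g i, unfolded gderiv_def])
  then show "grad_y f x (ylam l x) + l *\<^sub>R grad_y (psi A b g \<mu>) x (ylam l x) = 0"
    by (rule GDERIV_arg_min_zero[OF m open_interior])
qed

end

section \<open>Contraction within a round against drift between rounds\<close>

text \<open>The rate in this form makes explicit that \<open>n\<close> steps gain a fixed fraction of \<open>n x\<close>, the unit in
  which the drift of the centers is measured.\<close>

lemma power_le_inverse_linear:
  fixes x :: real assumes "0 \<le> x" "x \<le> 1"
  shows "(1 - x) ^ n \<le> 1 / (1 + real n * x)"
proof -
  have "(1 - x) ^ n * (1 + real n * x) \<le> (1 - x) ^ n * (1 + x) ^ n"
    using assms by (intro mult_left_mono Bernoulli_inequality) auto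
  also have "\<dots> = (1 - x\<^sup>2) ^ n"
    by (simp add: power2_eq_square algebra_simps flip: power_mult_distrib)
  also have "\<dots> \<le> 1" using assms by (intro power_le_one) (auto simp: power_le_one)
  finally show ?thesis using assms by (simp add: pos_le_divide_eq add_pos_nonneg)
qed

text \<open>The budget of one round. Contraction with accumulated rate \<open>p \<le> 1\<close> shrinks the radius \<open>\<eta>\<close> by at
  least \<open>p \<eta> / 2\<close>, while a drift \<open>s\<close> consumes \<open>s (1 + \<eta>) \<le> 3 s / 2\<close>, counting the change of metric.
  A drift of \<open>p \<eta> / 12\<close>, which is what the schedule allows both trackers, uses only a quarter of the
  gain.\<close>

lemma recentred_radius_bound:
  fixes \<eta> p s r :: real
  assumes \<eta>: "0 < \<eta>" "\<eta> < 1/2" and p: "0 \<le> p" "p \<le> 1"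
    and s: "s \<le> p * \<eta> / 12" and r: "r \<le> \<eta> / (1 + p)"
  shows "s < 1" "(r + s) / (1 - s) \<le> \<eta>"
proof -
  have pe: "p * \<eta> \<le> \<eta>" using p \<eta> by (simp add: mult_left_le_one_le)
  then show s1: "s < 1" using s \<eta> by linarith
  have "s * (1 + \<eta>) \<le> p * \<eta> / 12 * (1 + \<eta>)" using s \<eta> by (intro mult_right_mono) auto
  also have "\<dots> \<le> p * \<eta> / 12 * (3/2)" using p \<eta> by (intro mult_left_mono) auto
  also have "\<dots> \<le> p * \<eta> / 2" using p \<eta> by simp
  also have "\<dots> \<le> p * \<eta> / (1 + p)" using p \<eta> by (intro divide_left_mono) auto
  also have "\<dots> = \<eta> - \<eta> / (1 + p)" using p by (simp add: field_simps)
  finally have "r + s \<le> \<eta> * (1 - s)" using r by (simp add: algebra_simps)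
  then show "(r + s) / (1 - s) \<le> \<eta>" using s1 by (simp add: pos_divide_le_eq)
qed

context bounded_polytope
begin

section \<open>The two trackers\<close>

text \<open>Common core of the two trackers. The metric is frozen at the first iterate, which lies in the
  ball, so it is comparable with the center metric throughout the loop; the contraction keeps every
  iterate in the ball, where the curvature bounds hold, and so the induction closes.\<close>

lemma inner_loop_contraction:
  fixes q :: "real^'d \<Rightarrow> real^'d" and w :: "nat \<Rightarrow> real^'d"
  assumes c: "c \<in> interior Y" and \<eta>: "0 < \<eta>" "\<eta> < 1"
    and m: "0 < m" "theta \<eta> * L \<le> m / 4" and a: "0 \<le> a" "a * L \<le> 1"
    and qc: "q c = 0"
    and der: "\<And>y. y \<in> dikin_ball A b \<eta> c \<Longrightarrow> (q has_derivative (\<lambda>u. M y *v u)) (at y)"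
    and M: "\<And>y. y \<in> dikin_ball A b \<eta> c \<Longrightarrow> self_adjoint (M y)"
    and M_lo: "\<And>y u. y \<in> dikin_ball A b \<eta> c \<Longrightarrow>
        m * ((barrier_hess A b c *v u) \<bullet> u) \<le> (M y *v u) \<bullet> u"
    and M_up: "\<And>y u. y \<in> dikin_ball A b \<eta> c \<Longrightarrow>
        (M y *v u) \<bullet> u \<le> L * ((barrier_hess A b c *v u) \<bullet> u)"
    and w0: "w 0 \<in> dikin_ball A b \<eta> c"
    and step: "\<forall>t<T.
        w (Suc t) = w t - a *\<^sub>R (matrix_inv (barrier_hess A b (w 0)) *v q (w t))"
  shows rate_le: "3/4 * (a * m) \<le> 1"
    and inner_loop_distance:
      "t \<le> T \<Longrightarrow> mnorm (barrier_hess A b c) (w t - c) \<le> (1 - 3/4 * (a * m)) ^ t * \<eta>"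
    and inner_loop_stays: "t \<le> T \<Longrightarrow> w t \<in> dikin_ball A b \<eta> c"
proof -
  let ?H = "barrier_hess A b c" and ?N = "dikin_ball A b \<eta> c" and ?x = "3/4 * (a * m)"
  have H: "pos_def ?H" by (rule pos_def_barrier_hess[OF c])
  have cN: "c \<in> ?N" using \<eta> by (simp add: mem_dikin_ball c mnorm_def)
  have "m \<le> L" by (rule form_bounds_le[OF H M_lo[OF cN] M_up[OF cN]])
  then have "a * m \<le> 1" using a mult_left_mono[of m L a] by linarith
  then show x1: "?x \<le> 1" by simp
  have x0: "0 \<le> a * m" using a m by simp
  have P: "pos_def (barrier_hess A b (w 0))"
    using w0 by (intro pos_def_barrier_hess) (simp add: dikin_ball_def)
  have w0': "mnorm ?H (w 0 - c) \<le> \<eta>" using w0 by (simp add: dikin_ball_def)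
  have ball: "w t \<in> ?N" if "mnorm ?H (w t - c) \<le> (1 - ?x) ^ t * \<eta>" for t
  proof -
    have "(1 - ?x) ^ t * \<eta> \<le> 1 * \<eta>" using x0 x1 \<eta> by (intro mult_right_mono power_le_one) auto
    with that have "mnorm ?H (w t - c) \<le> \<eta>" by linarith
    then show ?thesis using \<eta> by (simp add: mem_dikin_ball c)
  qed
  have dist: "t \<le> T \<Longrightarrow> mnorm ?H (w t - c) \<le> (1 - ?x) ^ t * \<eta>" for t
  proof (induction t)
    case 0
    then show ?case using w0' by simp
  next
    case (Suc t)
    then have IH: "mnorm ?H (w t - c) \<le> (1 - ?x) ^ t * \<eta>" by simp
    have "mnorm ?H (w (Suc t) - c) \<le> (1 - ?x) * mnorm ?H (w t - c)"
      unfolding step[rule_format, OF Suc_le_lessD[OF Suc.prems]]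
      by (rule tracker_step[OF H P less_imp_le[OF \<eta>(1)] \<eta>(2)
            Dikin_metric_comparison[OF c w0' \<eta>(2)] m a convex_dikin_ball[OF c] cN ball[OF IH] qc
            der M M_lo M_up])
    also have "\<dots> \<le> (1 - ?x) * ((1 - ?x) ^ t * \<eta>)" using IH x1 by (intro mult_left_mono) auto
    finally show ?case by simp
  qed
  then show "t \<le> T \<Longrightarrow> mnorm ?H (w t - c) \<le> (1 - ?x) ^ t * \<eta>" .
  show "t \<le> T \<Longrightarrow> w t \<in> ?N" by (intro ball dist)
qed

text \<open>What the contraction has taken off the radius outweighs the drift of the center together with
  the change of metric, so that the last inner iterate is a valid warm start for the next round.\<close>

lemma warm_start_transfer:
  assumes c: "c \<in> interior Y" and c': "c' \<in> interior Y" and \<eta>: "0 < \<eta>" "\<eta> < 1/2"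
    and x: "0 \<le> x" "x \<le> 1" "real T * x \<le> 1"
    and w: "mnorm (barrier_hess A b c) (w - c) \<le> (1 - x) ^ T * \<eta>"
    and drift: "mnorm (barrier_hess A b c) (c' - c) \<le> real T * x * \<eta> / 12"
  shows "w \<in> dikin_ball A b \<eta> c'"
proof -
  have p: "0 \<le> real T * x" using x by simp
  have "(1 - x) ^ T * \<eta> \<le> 1 / (1 + real T * x) * \<eta>"
    using \<eta> x by (intro mult_right_mono power_le_inverse_linear) auto
  then have r: "(1 - x) ^ T * \<eta> \<le> \<eta> / (1 + real T * x)" by simp
  note rad = recentred_radius_bound[OF \<eta> p x(3) order_refl r]
  have "mnorm (barrier_hess A b c') (w - c') \<le> \<eta>"
    by (rule order_trans[OF recenter[OF c drift rad(1) w] rad(2)])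
  then show ?thesis using \<eta> by (simp add: mem_dikin_ball c')
qed

text \<open>The local constants hold on the ball of radius \<open>2 \<eta>\<close>, but all iterates and the segments to the
  center stay in that of radius \<open>\<eta>\<close>.\<close>

lemma psi_form_bounds:
  assumes lb: "local_bounds A b f g \<mu> K x c (dikin_ball A b (2 * \<eta>) c)"
    and \<eta>: "0 \<le> \<eta>" and y: "y \<in> dikin_ball A b \<eta> c"
  shows "rho_psi_eta K * ((barrier_hess A b c *v u) \<bullet> u) \<le> (hess_yy (psi A b g \<mu>) x y *v u) \<bullet> u"
    and "(hess_yy (psi A b g \<mu>) x y *v u) \<bullet> u \<le> lpsi1_eta K * ((barrier_hess A b c *v u) \<bullet> u)"
proof -
  have "y \<in> dikin_ball A b (2 * \<eta>) c" using y \<eta> by (auto simp: dikin_ball_def)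
  then have "loewner_le (rho_psi_eta K *\<^sub>R barrier_hess A b c) (hess_yy (psi A b g \<mu>) x y)"
    "loewner_le (hess_yy (psi A b g \<mu>) x y) (lpsi1_eta K *\<^sub>R barrier_hess A b c)"
    using lb by (simp_all add: local_bounds_def Let_def)
  then show "rho_psi_eta K * ((barrier_hess A b c *v u) \<bullet> u) \<le> (hess_yy (psi A b g \<mu>) x y *v u) \<bullet> u"
    and "(hess_yy (psi A b g \<mu>) x y *v u) \<bullet> u \<le> lpsi1_eta K * ((barrier_hess A b c *v u) \<bullet> u)"
    by (simp_all add: loewner_le_def flip: scaleR_matrix_vector_assoc)
qed

lemma f_form_bound:
  assumes c: "c \<in> interior Y"
    and lb: "local_bounds A b f g \<mu> K x c (dikin_ball A b (2 * \<eta>) c)"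
    and \<eta>: "0 \<le> \<eta>" and y: "y \<in> dikin_ball A b \<eta> c"
  shows "\<bar>(hess_yy f x y *v u) \<bullet> u\<bar> \<le> lf1_eta K * ((barrier_hess A b c *v u) \<bullet> u)"
proof -
  let ?H = "barrier_hess A b c"
  have H: "pos_def ?H" by (rule pos_def_barrier_hess[OF c])
  have "y \<in> dikin_ball A b (2 * \<eta>) c" using y \<eta> by (auto simp: dikin_ball_def)
  then have "onorm_c_dual ?H (hess_yy f x y) \<le> lf1_eta K"
    using lb by (simp add: local_bounds_def Let_def)
  then have "onorm_c_dual ?H (hess_yy f x y) * ((?H *v u) \<bullet> u) \<le> lf1_eta K * ((?H *v u) \<bullet> u)"
    by (rule mult_right_mono[OF _ pos_def_nonneg[OF H]])
  then show ?thesis using quadratic_form_le_onorm_c_dual[OF H, of "hess_yy f x y" u] by linarith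
qed

lemma lpsi1_ge_rho:
  assumes c: "c \<in> interior Y" and lb: "local_bounds A b f g \<mu> K x c (dikin_ball A b (2 * \<eta>) c)"
    and \<eta>: "0 \<le> \<eta>"
  shows "rho_psi_eta K \<le> lpsi1_eta K"
proof -
  have "c \<in> dikin_ball A b \<eta> c" using c \<eta> by (simp add: dikin_ball_def mnorm_def)
  from psi_form_bounds[OF lb \<eta> this] show ?thesis
    by (rule form_bounds_le[OF pos_def_barrier_hess[OF c]])
qed

lemma exact_tracker:
  fixes g :: "(real^'n) \<times> (real^'d) \<Rightarrow> real" and x :: "real^'n" and w :: "nat \<Rightarrow> real^'d"
    and \<mu> :: real
  defines "c \<equiv> y_mu A b g \<mu> x"
  assumes g: "C2 g" and \<mu>: "0 < \<mu>" and \<eta>: "0 < \<eta>" "\<eta> < 1"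
    and lb: "local_bounds A b f g \<mu> K x c (T_exact A b g \<mu> (2 * \<eta>) x)"
    and K: "0 < rho_psi_eta K" "theta \<eta> * lpsi1_eta K \<le> rho_psi_eta K / 4"
    and a: "0 \<le> a" "a * lpsi1_eta K \<le> 1"
    and w0: "w 0 \<in> T_exact A b g \<mu> \<eta> x"
    and step: "\<forall>t<T. w (Suc t) = w t - a *\<^sub>R
        (matrix_inv (barrier_hess A b (w 0)) *v grad_y (psi A b g \<mu>) x (w t))"
  shows exact_rate_le: "3/4 * (a * rho_psi_eta K) \<le> 1"
    and exact_distance: "t \<le> T \<Longrightarrow> mnorm (barrier_hess A b c) (w t - c)
          \<le> (1 - 3/4 * (a * rho_psi_eta K)) ^ t * \<eta>"
    and exact_stays: "t \<le> T \<Longrightarrow> w t \<in> T_exact A b g \<mu> \<eta> x"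
proof -
  have c: "c \<in> interior Y" and st: "grad_y (psi A b g \<mu>) x c = 0"
    unfolding c_def by (rule y_mu_stationary[OF g \<mu>])+
  note lb' = lb[unfolded T_exact_def, folded c_def]
  have inY: "y \<in> interior Y" if "y \<in> dikin_ball A b \<eta> c" for y
    using that by (simp add: dikin_ball_def)
  note tr = inner_loop_contraction[where q = "grad_y (psi A b g \<mu>) x"
      and M = "hess_yy (psi A b g \<mu>) x" and w = w,
      OF c \<eta> K a st psi_grad_y_has_derivative[OF g inY] psi_hess_yy_self_adjoint[OF g inY]
      psi_form_bounds[OF lb' less_imp_le[OF \<eta>(1)]] w0[unfolded T_exact_def, folded c_def] step]
  show "3/4 * (a * rho_psi_eta K) \<le> 1" by (rule tr(1))
  show "t \<le> T \<Longrightarrow> mnorm (barrier_hess A b c) (w t - c) \<le> (1 - 3/4 * (a * rho_psi_eta K)) ^ t * \<eta>"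
    by (rule tr(2))
  show "t \<le> T \<Longrightarrow> w t \<in> T_exact A b g \<mu> \<eta> x"
    unfolding T_exact_def c_def[symmetric] by (rule tr(3))
qed

text \<open>A large multiplier makes the penalty dominate: the curvature of \<open>f\<close> is at most half of the
  curvature \<open>l * rho_psi_eta K\<close> of the penalty term, so that the penalized objective has the curvature
  pair \<open>(l \<rho> / 2, l L + lf1)\<close>.\<close>

lemma proxy_tracker:
  fixes ylam :: "real \<Rightarrow> real^'n \<Rightarrow> real^'d" and x :: "real^'n" and w :: "nat \<Rightarrow> real^'d"
    and l :: real
  defines "c \<equiv> ylam l x"
  assumes f: "C2 f" and g: "C2 g" and sel: "penalized_selection A b f g \<mu> ylam" and l: "0 < l"
    and \<eta>: "0 < \<eta>" "\<eta> < 1"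
    and lb: "local_bounds A b f g \<mu> K x c (T_proxy A b ylam (2 * \<eta>) l x)"
    and K: "0 < rho_psi_eta K" "2 * lf1_eta K \<le> l * rho_psi_eta K"
      "theta \<eta> * (l * lpsi1_eta K + lf1_eta K) \<le> (l * rho_psi_eta K / 2) / 4"
    and a: "0 \<le> a" "a * (l * lpsi1_eta K + lf1_eta K) \<le> 1"
    and w0: "w 0 \<in> T_proxy A b ylam \<eta> l x"
    and step: "\<forall>t<T. w (Suc t) = w t - a *\<^sub>R (matrix_inv (barrier_hess A b (w 0)) *v
        (grad_y f x (w t) + l *\<^sub>R grad_y (psi A b g \<mu>) x (w t)))"
  shows proxy_rate_le: "3/4 * (a * (l * rho_psi_eta K / 2)) \<le> 1"
    and proxy_distance: "t \<le> T \<Longrightarrow> mnorm (barrier_hess A b c) (w t - c)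
          \<le> (1 - 3/4 * (a * (l * rho_psi_eta K / 2))) ^ t * \<eta>"
    and proxy_stays: "t \<le> T \<Longrightarrow> w t \<in> T_proxy A b ylam \<eta> l x"
proof -
  let ?q = "\<lambda>y. grad_y f x y + l *\<^sub>R grad_y (psi A b g \<mu>) x y"
  let ?M = "\<lambda>y. hess_yy f x y + l *\<^sub>R hess_yy (psi A b g \<mu>) x y"
  let ?N = "dikin_ball A b \<eta> c" and ?H = "barrier_hess A b c"
  have c: "c \<in> interior Y" and st: "?q c = 0"
    unfolding c_def by (rule ylam_stationary[OF f g sel l])+
  note lb' = lb[unfolded T_proxy_def, folded c_def]
  have inY: "y \<in> interior Y" if "y \<in> ?N" for y using that by (simp add: dikin_ball_def)
  have m: "0 < l * rho_psi_eta K / 2" using l K by simp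
  have der: "(?q has_derivative (\<lambda>u. ?M y *v u)) (at y)" if "y \<in> ?N" for y
    unfolding matrix_vector_mult_add_rdistrib scaleR_matrix_vector_assoc[symmetric]
    by (intro has_derivative_add has_derivative_scaleR_right C2_grad_y_has_derivative f
        psi_grad_y_has_derivative g inY that)
  have sa: "self_adjoint (?M y)" if "y \<in> ?N" for y
    by (intro self_adjoint_add self_adjoint_scaleR C2_hess_yy_self_adjoint
        psi_hess_yy_self_adjoint f g inY that)
  have form: "l * rho_psi_eta K / 2 * ((?H *v u) \<bullet> u) \<le> (?M y *v u) \<bullet> u \<and>
      (?M y *v u) \<bullet> u \<le> (l * lpsi1_eta K + lf1_eta K) * ((?H *v u) \<bullet> u)" if y: "y \<in> ?N" for y u
  proof -
    have e: "(?M y *v u) \<bullet> u = (hess_yy f x y *v u) \<bullet> u + l * ((hess_yy (psi A b g \<mu>) x y *v u) \<bullet> u)"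
      by (simp add: matrix_vector_mult_add_rdistrib inner_add_left flip: scaleR_matrix_vector_assoc)
    have q: "0 \<le> (?H *v u) \<bullet> u" by (rule pos_def_nonneg[OF pos_def_barrier_hess[OF c]])
    note psi_b = psi_form_bounds[OF lb' less_imp_le[OF \<eta>(1)] y, of u, THEN mult_left_mono,
        OF less_imp_le[OF l]]
    have "2 * lf1_eta K * ((?H *v u) \<bullet> u) \<le> l * rho_psi_eta K * ((?H *v u) \<bullet> u)"
      by (rule mult_right_mono[OF K(2) q])
    then show ?thesis
      using psi_b f_form_bound[OF c lb' less_imp_le[OF \<eta>(1)] y, of u]
      unfolding e by (simp add: algebra_simps abs_le_iff)
  qed
  note tr = inner_loop_contraction[where q = ?q and M = ?M and w = w,
      OF c \<eta> m K(3) a st der sa form[THEN conjunct1] form[THEN conjunct2]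
      w0[unfolded T_proxy_def, folded c_def] step]
  show "3/4 * (a * (l * rho_psi_eta K / 2)) \<le> 1" by (rule tr(1))
  show "t \<le> T \<Longrightarrow> mnorm ?H (w t - c) \<le> (1 - 3/4 * (a * (l * rho_psi_eta K / 2))) ^ t * \<eta>"
    by (rule tr(2))
  show "t \<le> T \<Longrightarrow> w t \<in> T_proxy A b ylam \<eta> l x"
    unfolding T_proxy_def c_def[symmetric] by (rule tr(3))
qed

end

section \<open>Forward invariance\<close>

lemma outer_step_length:
  assumes run: "barrier_metric_run A b f g \<mu> T \<xi> \<alpha> \<gamma> lam \<delta> x z y zi yi"
    and reg: "objective_regularity f g R"
    and pos: "0 \<le> \<xi>" "0 \<le> \<alpha> k" "0 < l0" "l0 \<le> lam k"
  shows "norm (x (Suc k) - x k) \<le> \<xi> * (\<alpha> k * lam k) * (lf0 R / l0 + 2 * lg0 R)"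
proof -
  let ?qf = "grad_x f (x k) (y (Suc k))"
  let ?qy = "grad_x g (x k) (y (Suc k))" and ?qz = "grad_x g (x k) (z (Suc k))"
  have l: "0 < lam k" using pos by simp
  have bf: "norm ?qf \<le> lf0 R" and bg: "norm ?qy \<le> lg0 R" "norm ?qz \<le> lg0 R"
    using reg by (auto simp: objective_regularity_def)
  have lf0: "0 \<le> lf0 R" using bf norm_ge_zero order_trans by blast
  have "norm (?qf + lam k *\<^sub>R (?qy - ?qz)) \<le> norm ?qf + lam k * norm (?qy - ?qz)"
    using norm_triangle_ineq[of ?qf "lam k *\<^sub>R (?qy - ?qz)"] l by simp
  also have "\<dots> \<le> lf0 R + lam k * (2 * lg0 R)"
    using bf bg l norm_triangle_ineq4[of ?qy ?qz] by (intro add_mono mult_left_mono) auto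
  also have "\<dots> = lam k * (lf0 R / lam k + 2 * lg0 R)" using l by (simp add: field_simps)
  also have "\<dots> \<le> lam k * (lf0 R / l0 + 2 * lg0 R)"
    using l pos lf0 by (intro mult_left_mono add_mono divide_left_mono) auto
  finally have "norm (?qf + lam k *\<^sub>R (?qy - ?qz)) \<le> lam k * (lf0 R / l0 + 2 * lg0 R)" .
  moreover have "x (Suc k) - x k = - ((\<xi> * \<alpha> k) *\<^sub>R (?qf + lam k *\<^sub>R (?qy - ?qz)))"
    using run by (simp add: barrier_metric_run_def)
  then have "norm (x (Suc k) - x k) = \<xi> * \<alpha> k * norm (?qf + lam k *\<^sub>R (?qy - ?qz))"
    using pos by simp
  ultimately have "norm (x (Suc k) - x k) \<le> \<xi> * \<alpha> k * (lam k * (lf0 R / l0 + 2 * lg0 R))"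
    using pos by (simp add: mult_left_mono)
  then show ?thesis by (simp add: mult.assoc)
qed

theorem theorem2:
  fixes A :: "real^'d^'m" and b :: "real^'m"
    and f g :: "(real^'n) \<times> (real^'d) \<Rightarrow> real"
    and R :: regularity_constants and K :: dikin_constants
    and \<mu> \<eta> \<xi> c\<^sub>\<xi> :: real and T :: nat
    and ylam :: "real \<Rightarrow> real^'n \<Rightarrow> real^'d"
    and \<alpha> \<gamma> lam \<delta> :: "nat \<Rightarrow> real"
    and x :: "nat \<Rightarrow> real^'n" and z y :: "nat \<Rightarrow> real^'d"
    and zi yi :: "nat \<Rightarrow> nat \<Rightarrow> real^'d"
  assumes "compact (Ypoly A b)" and "interior (Ypoly A b) \<noteq> {}"
    and "bdd_below (range (\<lambda>x. f (x, lower_sol A b g x)))"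
    and "objective_regularity f g R"
    and "\<mu> > 0" and "0 < \<eta>" and "\<eta> < 1/2"
    and "T \<ge> 1" and "\<xi> > 0" and "c\<^sub>\<xi> > 0"
    and "penalized_selection A b f g \<mu> ylam"
    and "local_constants A b f g \<mu> ylam \<eta> K"
    and "path_constants A b f g \<mu> ylam (lam 0) K"
    and "radius_small \<eta> (lam 0) K"
    and "lam 0 \<ge> lam_eta K"
    and "barrier_aware_schedule R K \<eta> c\<^sub>\<xi> T \<xi> \<alpha> \<gamma> lam \<delta>"
    and "barrier_metric_run A b f g \<mu> T \<xi> \<alpha> \<gamma> lam \<delta> x z y zi yi"
    and "z 0 \<in> T_exact A b g \<mu> \<eta> (x 0)"
    and "y 0 \<in> T_proxy A b ylam \<eta> (lam 0) (x 0)"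
  shows "(\<forall>k. (\<forall>t\<le>T. zi k t \<in> T_exact A b g \<mu> \<eta> (x k))
            \<and> (\<forall>t\<le>T. yi k t \<in> T_proxy A b ylam \<eta> (lam k) (x k))
            \<and> z (Suc k) \<in> T_exact A b g \<mu> \<eta> (x (Suc k))
            \<and> y (Suc k) \<in> T_proxy A b ylam \<eta> (lam (Suc k)) (x (Suc k)))
       \<and> (\<forall>k. z k \<in> T_exact A b g \<mu> \<eta> (x k) \<and> y k \<in> T_proxy A b ylam \<eta> (lam k) (x k))"
proof -
  interpret bounded_polytope A b by unfold_locales (fact assms)+
  define \<rho> L D where "\<rho> = rho_psi_eta K" and "L = lpsi1_eta K" and "D = lf0 R / lam 0 + 2 * lg0 R"
  note \<mu> = \<open>\<mu> > 0\<close> and T = \<open>T \<ge> 1\<close> and \<xi> = \<open>\<xi> > 0\<close>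
  note sel = \<open>penalized_selection A b f g \<mu> ylam\<close>
  have \<eta>: "0 < \<eta>" "\<eta> < 1/2" "\<eta> < 1" using assms(6,7) by auto
  have f: "C2 f" and g: "C2 g" using assms(4) by (auto simp: objective_regularity_def)
  note run = \<open>barrier_metric_run A b f g \<mu> T \<xi> \<alpha> \<gamma> lam \<delta> x z y zi yi\<close>
  have lam0: "0 < lam 0" "2 * lf1_eta K / \<rho> \<le> lam 0" "8 * lf0_eta K / (\<eta> * \<rho>) \<le> lam 0"
    and gam: "\<And>k. \<alpha> k * lam k \<le> \<gamma> k" "\<And>k. \<gamma> k \<le> 1 / (4 * L)" "\<And>k. \<gamma> k \<le> 1 / (4 * real T * \<rho>)"
    and del: "\<And>k. \<delta> k / lam k \<le> real T * \<rho> * (\<alpha> k * lam k) / 16"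
      "\<And>k. \<delta> k = lam (Suc k) - lam k" "\<And>k. 0 \<le> \<delta> k"
    and xi: "\<xi> / real T * (16 * lstar0_eta K * D) \<le> \<eta> * \<rho>"
      "\<xi> / real T * (64 * llam0_eta K * D) \<le> \<eta> * \<rho>"
    using assms(16)
    unfolding barrier_aware_schedule_def Let_def \<rho>_def L_def D_def max.bounded_iff min.bounded_iff
    by blast+
  have \<rho>: "0 < \<rho>"
    and lbz: "\<And>x. local_bounds A b f g \<mu> K x (y_mu A b g \<mu> x) (T_exact A b g \<mu> (2 * \<eta>) x)"
    and lby: "\<And>x l. lam_eta K \<le> l \<Longrightarrow> 0 < l \<Longrightarrow>
        local_bounds A b f g \<mu> K x (ylam l x) (T_proxy A b ylam (2 * \<eta>) l x)"
    using assms(12) by (auto simp: local_constants_def \<rho>_def)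
  have small: "theta \<eta> * L \<le> \<rho> / 4"
    "\<And>l. lam 0 \<le> l \<Longrightarrow> theta \<eta> * (l * L + lf1_eta K) \<le> (l * \<rho> / 2) / 4"
    using assms(14) by (auto simp: radius_small_def \<rho>_def L_def)
  have star: "1 \<le> lstar0_eta K" "\<And>x1 x2. mnorm (barrier_hess A b (y_mu A b g \<mu> x1))
        (y_mu A b g \<mu> x2 - y_mu A b g \<mu> x1) \<le> lstar0_eta K * norm (x2 - x1)"
    and path: "\<And>x1 x2 l1 l2. lam 0 \<le> l1 \<Longrightarrow> lam 0 \<le> l2 \<Longrightarrow>
        mnorm (barrier_hess A b (ylam l1 x1)) (ylam l2 x2 - ylam l1 x1)
          \<le> 2 * lf0_eta K / \<rho> * \<bar>1 / l2 - 1 / l1\<bar> + llam0_eta K * norm (x2 - x1)"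
    using assms(13) unfolding path_constants_def Let_def \<rho>_def by blast+

  have lamk: "lam 0 \<le> lam k" for k
  proof (induction k)
    case (Suc k)
    then show ?case using del(2,3)[of k] by linarith
  qed simp
  have lampos: "0 < lam k" for k using lamk[of k] lam0 by linarith
  have \<rho>L: "\<rho> \<le> L" unfolding \<rho>_def L_def
    using lpsi1_ge_rho[OF y_mu_interior[OF g \<mu>] lbz[unfolded T_exact_def]] \<eta> by simp
  have lf1: "2 * lf1_eta K \<le> lam k * \<rho>" for k
    using lam0(2) lamk[of k] \<rho> by (simp add: pos_divide_le_eq) (smt (verit) mult_right_mono)
  \<comment> \<open>Signs of the step sizes come from the multiplier increments being nonnegative.\<close>
  have \<beta>: "0 \<le> \<alpha> k * lam k" for k
  proof -
    have "0 \<le> \<delta> k / lam k" using del(3)[of k] lampos[of k] by simp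
    then have "0 \<le> real T * \<rho> * (\<alpha> k * lam k)" using del(1)[of k] by linarith
    moreover have "0 < real T * \<rho>" using T \<rho> by simp
    ultimately show ?thesis using zero_le_mult_iff by (metis less_le_not_le)
  qed
  have \<alpha>: "0 \<le> \<alpha> k" for k using \<beta>[of k] lampos[of k] by (simp add: zero_le_mult_iff)
  have \<gamma>: "0 \<le> \<gamma> k" for k using \<beta>[of k] gam(1)[of k] by linarith
  have \<gamma>L: "\<gamma> k * L \<le> 1/4" for k
    using gam(2)[of k] \<rho> \<rho>L by (simp add: field_simps)
  have \<gamma>T: "real T * (\<gamma> k * \<rho>) \<le> 1/4" for k
    using gam(3)[of k] \<rho> T by (simp add: field_simps)
  have \<beta>T: "real T * (\<alpha> k * lam k * \<rho>) \<le> real T * (\<gamma> k * \<rho>)" for k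
    using gam(1)[of k] \<rho> by (intro mult_left_mono mult_right_mono) auto
  have \<alpha>L: "\<alpha> k * (lam k * L + lf1_eta K) \<le> 1" for k
  proof -
    have "\<alpha> k * (2 * lf1_eta K) \<le> \<alpha> k * (lam k * \<rho>)" by (rule mult_left_mono[OF lf1 \<alpha>])
    moreover have "\<alpha> k * lam k * \<rho> \<le> \<alpha> k * lam k * L" by (rule mult_left_mono[OF \<rho>L \<beta>])
    moreover have "\<alpha> k * lam k * L \<le> \<gamma> k * L" using gam(1) \<rho> \<rho>L by (intro mult_right_mono) auto
    ultimately show ?thesis using \<gamma>L[of k] by (simp add: algebra_simps)
  qed
  \<comment> \<open>Dual norms are nonnegative and the center itself belongs to the neighborhood.\<close>
  have lf0\<eta>: "0 \<le> lf0_eta K"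
  proof -
    let ?c = "y_mu A b g \<mu> (x 0)"
    have c: "?c \<in> interior Y" by (rule y_mu_interior[OF g \<mu>])
    then have "?c \<in> T_exact A b g \<mu> (2 * \<eta>) (x 0)"
      using \<eta> by (simp add: T_exact_def dikin_ball_def mnorm_def)
    then have "mnorm_dual (barrier_hess A b ?c) (grad_y f (x 0) ?c) \<le> lf0_eta K"
      using lbz[of "x 0"] by (simp add: local_bounds_def Let_def)
    moreover have "0 \<le> mnorm_dual (barrier_hess A b ?c) (grad_y f (x 0) ?c)"
      by (simp add: mnorm_dual_eq_mnorm_inv mnorm_nonneg pos_def_matrix_inv pos_def_barrier_hess c)
    ultimately show ?thesis by linarith
  qed
  have dx: "norm (x (Suc k) - x k) \<le> \<xi> * (\<alpha> k * lam k) * D" for k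
    unfolding D_def using outer_step_length[OF run assms(4) _ \<alpha> lam0(1) lamk] \<xi> by simp

  \<comment> \<open>In units of \<open>\<eta>\<close>, the schedule allows a drift of one sixteenth of \<open>T \<gamma> \<rho>\<close>, which is one twelfth of
    the accumulated rate \<open>3/4 T \<gamma> \<rho>\<close> of the exact tracker.\<close>
  have drift_exact: "mnorm (barrier_hess A b (y_mu A b g \<mu> (x k)))
      (y_mu A b g \<mu> (x (Suc k)) - y_mu A b g \<mu> (x k))
        \<le> real T * (3/4 * (\<gamma> k * \<rho>)) * \<eta> / 12" for k
  proof -
    have "lstar0_eta K * norm (x (Suc k) - x k) \<le> lstar0_eta K * (\<xi> * (\<alpha> k * lam k) * D)"
      using star(1) by (intro mult_left_mono dx) auto
    also have "\<dots> = real T * (\<alpha> k * lam k) / 16 * (\<xi> / real T * (16 * lstar0_eta K * D))"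
      using T by simp
    also have "\<dots> \<le> real T * (\<alpha> k * lam k) / 16 * (\<eta> * \<rho>)"
      using \<beta>[of k] by (intro mult_left_mono xi) auto
    also have "\<dots> = real T * (\<alpha> k * lam k * \<rho>) * (\<eta> / 16)" by simp
    also have "\<dots> \<le> real T * (\<gamma> k * \<rho>) * (\<eta> / 16)" using \<eta> by (intro mult_right_mono \<beta>T) auto
    also have "\<dots> = real T * (3/4 * (\<gamma> k * \<rho>)) * \<eta> / 12" by simp
    finally show ?thesis by (rule order_trans[OF star(2)])
  qed
  \<comment> \<open>The proxy center moves with the multiplier and with \<open>x\<close>; each motion takes at most \<open>\<eta> \<tau> / 64\<close>. Since the
    curvature is halved, the accumulated rate is \<open>3/8 \<tau>\<close>, and a twelfth of it is \<open>\<tau> / 32\<close>.\<close>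
  have drift_proxy: "mnorm (barrier_hess A b (ylam (lam k) (x k)))
      (ylam (lam (Suc k)) (x (Suc k)) - ylam (lam k) (x k))
        \<le> real T * (3/4 * (\<alpha> k * (lam k * \<rho> / 2))) * \<eta> / 12" for k
  proof -
    define \<tau> where "\<tau> = real T * \<rho> * (\<alpha> k * lam k)"
    have \<tau>: "0 \<le> \<tau>" using \<rho> \<beta>[of k] by (simp add: \<tau>_def)
    have "1 / lam (Suc k) \<le> 1 / lam k"
      using del(2,3)[of k] lampos by (intro divide_left_mono) auto
    then have "\<bar>1 / lam (Suc k) - 1 / lam k\<bar> = 1 / lam k - 1 / lam (Suc k)" by simp
    also have "\<dots> = \<delta> k / lam k / lam (Suc k)"
      unfolding del(2)[of k] using lampos[of k] lampos[of "Suc k"]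
      by (simp add: diff_divide_distrib)
    also have "\<dots> \<le> (\<tau> / 16) / lam 0"
      by (rule frac_le[OF _ del(1)[of k, folded \<tau>_def] lam0(1) lamk]) (use \<tau> in simp)
    finally have "2 * lf0_eta K / \<rho> * \<bar>1 / lam (Suc k) - 1 / lam k\<bar>
        \<le> 2 * lf0_eta K / \<rho> * ((\<tau> / 16) / lam 0)"
      using lf0\<eta> \<rho> by (intro mult_left_mono) auto
    also have "\<dots> = (8 * lf0_eta K / (\<eta> * \<rho>)) / lam 0 * (\<eta> * \<tau> / 64)" using \<eta> by simp
    also have "\<dots> \<le> 1 * (\<eta> * \<tau> / 64)"
    proof (rule mult_right_mono)
      show "8 * lf0_eta K / (\<eta> * \<rho>) / lam 0 \<le> 1"
        unfolding pos_divide_le_eq[OF lam0(1)] using lam0(3) by simp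
      show "0 \<le> \<eta> * \<tau> / 64" using \<eta> \<tau> by simp
    qed
    finally have 1: "2 * lf0_eta K / \<rho> * \<bar>1 / lam (Suc k) - 1 / lam k\<bar> \<le> \<eta> * \<tau> / 64" by simp
    have 2: "llam0_eta K * norm (x (Suc k) - x k) \<le> \<eta> * \<tau> / 64"
    proof (cases "0 \<le> llam0_eta K")
      case True
      then have "llam0_eta K * norm (x (Suc k) - x k) \<le> llam0_eta K * (\<xi> * (\<alpha> k * lam k) * D)"
        by (intro mult_left_mono dx)
      also have "\<dots> = real T * (\<alpha> k * lam k) / 64 * (\<xi> / real T * (64 * llam0_eta K * D))"
        using T by simp
      also have "\<dots> \<le> real T * (\<alpha> k * lam k) / 64 * (\<eta> * \<rho>)"
        using \<beta>[of k] by (intro mult_left_mono xi) auto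
      finally show ?thesis by (simp add: \<tau>_def mult_ac)
    next
      case False
      then have "llam0_eta K * norm (x (Suc k) - x k) \<le> 0" by (simp add: mult_nonpos_nonneg)
      moreover have "0 \<le> \<eta> * \<tau> / 64" using \<eta> \<tau> by simp
      ultimately show ?thesis by linarith
    qed
    have "real T * (3/4 * (\<alpha> k * (lam k * \<rho> / 2))) * \<eta> / 12 = \<eta> * \<tau> / 64 + \<eta> * \<tau> / 64"
      by (simp add: \<tau>_def)
    then show ?thesis using path[OF lamk[of k] lamk[of "Suc k"], of "x k" "x (Suc k)"] 1 2 by linarith
  qed

  have round: "(\<forall>t\<le>T. zi k t \<in> T_exact A b g \<mu> \<eta> (x k))
      \<and> (\<forall>t\<le>T. yi k t \<in> T_proxy A b ylam \<eta> (lam k) (x k))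
      \<and> z (Suc k) \<in> T_exact A b g \<mu> \<eta> (x (Suc k))
      \<and> y (Suc k) \<in> T_proxy A b ylam \<eta> (lam (Suc k)) (x (Suc k))"
    if z: "z k \<in> T_exact A b g \<mu> \<eta> (x k)" and y: "y k \<in> T_proxy A b ylam \<eta> (lam k) (x k)" for k
  proof -
    have init: "zi k 0 = z k" "yi k 0 = y k" and nxt: "z (Suc k) = zi k T" "y (Suc k) = yi k T"
      and stz: "\<forall>t<T. zi k (Suc t) = zi k t - \<gamma> k *\<^sub>R
          (matrix_inv (barrier_hess A b (zi k 0)) *v grad_y (psi A b g \<mu>) (x k) (zi k t))"
      and sty: "\<forall>t<T. yi k (Suc t) = yi k t - \<alpha> k *\<^sub>R
          (matrix_inv (barrier_hess A b (yi k 0)) *v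
            (grad_y f (x k) (yi k t) + lam k *\<^sub>R grad_y (psi A b g \<mu>) (x k) (yi k t)))"
      using run by (auto simp: barrier_metric_run_def)
    have g1: "\<gamma> k * L \<le> 1" using \<gamma>L[of k] by linarith
    have le: "lam_eta K \<le> lam k" using assms(15) lamk[of k] by linarith
    note Z = exact_tracker[OF g \<mu> \<eta>(1,3) lbz \<rho>[unfolded \<rho>_def] small(1)[unfolded \<rho>_def L_def]
        \<gamma> g1[unfolded L_def] z[folded init(1)] stz, folded \<rho>_def]
    note P = proxy_tracker[OF f g sel lampos \<eta>(1,3) lby[OF le lampos] \<rho>[unfolded \<rho>_def]
        lf1[unfolded \<rho>_def] small(2)[OF lamk, unfolded \<rho>_def L_def] \<alpha> \<alpha>L[unfolded L_def]
        y[folded init(2)] sty, folded \<rho>_def]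
    have "0 \<le> 3/4 * (\<gamma> k * \<rho>)" "real T * (3/4 * (\<gamma> k * \<rho>)) \<le> 1"
      using \<gamma>[of k] \<rho> \<gamma>T[of k] by simp_all
    then have "z (Suc k) \<in> T_exact A b g \<mu> \<eta> (x (Suc k))"
      unfolding nxt T_exact_def
      by (intro warm_start_transfer[OF y_mu_interior[OF g \<mu>] y_mu_interior[OF g \<mu>] \<eta>(1,2)
            _ Z(1) _ Z(2)[OF order_refl] drift_exact])
    moreover have "0 \<le> 3/4 * (\<alpha> k * (lam k * \<rho> / 2))" using \<beta>[of k] \<rho> by (simp flip: mult.assoc)
    moreover have "real T * (3/4 * (\<alpha> k * (lam k * \<rho> / 2))) \<le> 1"
      using \<beta>T[of k] \<gamma>T[of k] by (simp add: mult.assoc)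
    ultimately show ?thesis
      unfolding nxt T_proxy_def
      using Z(3) P(3) warm_start_transfer[OF ylam_interior[OF f g sel lampos]
          ylam_interior[OF f g sel lampos] \<eta>(1,2) _ P(1) _ P(2)[OF order_refl] drift_proxy]
      by (auto simp: nxt T_proxy_def)
  qed
  have "z k \<in> T_exact A b g \<mu> \<eta> (x k) \<and> y k \<in> T_proxy A b ylam \<eta> (lam k) (x k)" for k
    by (induction k) (use assms(18,19) round in auto)
  then show ?thesis using round by blast
qed

end
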